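(* Let $\nu$ be a probability measure on $\mathbb{R}^d$ that is absolutely continuous with respect to the Lebesgue measure and has a finite second moment. Let $(\mathsf{X}_t)_{t\in[0,1]}$ be the Gaussian stochastic interpolation from $\mu=\mathrm{Law}(\mathsf{X}_0)$ to $\nu$, i.e. $\mathsf{X}_t=a_t\mathsf{Z}+b_t\mathsf{X}_1$, and let $p_t$ denote the density of $\mathsf{X}_t$. Then the marginal flow $(p_t)_{t\in[0,1]}$ satisfies, in the weak sense, the continuity equation $$\partial_t p_t+\nabla_x\cdot(p_t\,v(t,x))=0,\quad (t,x)\in[0,1]\times\mathbb{R}^d,\qquad p_0(x)=\frac{d\mu}{dx}(x),\quad p_1(x)=\frac{d\nu}{dx}(x),$$ with the velocity field $$v(t,x):=\mathbb{E}[\dot a_t\mathsf{Z}+\dot b_t\mathsf{X}_1\mid \mathsf{X}_t=x],\quad t\in(0,1),\qquad v(0,x):=\lim_{t\downarrow0}v(t,x),\quad v(1,x):=\lim_{t\uparrow1}v(t,x).$$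
   Context: Fix functions $a_t,b_t$ of $t\in[0,1]$ (a dot denotes the time derivative) satisfying: $\dot a_t\le 0$, $\dot b_t\ge 0$, $a_0>0$, $b_0\ge 0$, $a_1=0$, $b_1=1$; $a_t>0$ and $b_t>0$ for all $t\in(0,1)$; $a_t,b_t\in C^2([0,1))$, $a_t^2\in C^1([0,1])$, $b_t\in C^1([0,1])$. Let $\mathsf{Z}\sim\gamma_d:=N(0,\mathbf{I}_d)$ and $\mathsf{X}_1\sim\nu$ be independent. The Gaussian stochastic interpolation is $\mathsf{X}_t=a_t\mathsf{Z}+b_t\mathsf{X}_1$ for $t\in[0,1]$; in particular $\mathsf{X}_0=a_0\mathsf{Z}+b_0\mathsf{X}_1$ and $\mu=\mathrm{Law}(\mathsf{X}_0)$.
   Formalization: Existence of the limit defining v(1,x) is not claimed, since it can fail (a_t=1-t, b_t=t, ν uniform on [0,1], x=2 gives v(t,x) → -∞); v(1,x) is the limit where it exists and unspecified elsewhere, and the weak equation does not depend on it. *)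

theory Defs
  imports "HOL-Probability.Probability"
begin

text \<open>
  Continuous differentiability of order \<open>k\<close> on a set. Derivatives are taken within \<open>S\<close>, so they are
  one-sided at the end points of an interval. In finite dimension, continuity of every
  directional derivative is the usual continuity of the differential.
\<close>

primrec C_k_on :: "nat \<Rightarrow> ('a::real_normed_vector \<Rightarrow> 'b::real_normed_vector) \<Rightarrow> 'a set \<Rightarrow> bool" where
  "C_k_on 0 f S \<longleftrightarrow> continuous_on S f"
| "C_k_on (Suc k) f S \<longleftrightarrow>
     (\<exists>f'. (\<forall>x\<in>S. (f has_derivative f' x) (at x within S)) \<and> (\<forall>h. C_k_on k (\<lambda>x. f' x h) S))"

definition test_function :: "('a::real_normed_vector \<Rightarrow> real) \<Rightarrow> bool" where
  "test_function \<phi> \<longleftrightarrow> (\<forall>k. C_k_on k \<phi> UNIV) \<and> compact (closure {z. \<phi> z \<noteq> 0})"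

definition time_deriv :: "(real \<Rightarrow> real) \<Rightarrow> real \<Rightarrow> real" where
  "time_deriv f t = vector_derivative f (at t within {0..1})"

text \<open>
  No derivative of \<open>a\<close> is required at time 1 (consider \<open>a t = sqrt (1 - t\<^sup>2)\<close>); its sign condition
  is imposed wherever \<open>a\<close> is assumed differentiable.
\<close>

definition interpolation_schedule :: "(real \<Rightarrow> real) \<Rightarrow> (real \<Rightarrow> real) \<Rightarrow> bool" where
  "interpolation_schedule a b \<longleftrightarrow>
     (\<forall>t\<in>{0..<1}. time_deriv a t \<le> 0) \<and> (\<forall>t\<in>{0..1}. time_deriv b t \<ge> 0) \<and>
     a 0 > 0 \<and> b 0 \<ge> 0 \<and> a 1 = 0 \<and> b 1 = 1 \<and>
     (\<forall>t\<in>{0<..<1}. a t > 0 \<and> b t > 0) \<and>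
     C_k_on 2 a {0..<1} \<and> C_k_on 2 b {0..<1} \<and>
     C_k_on 1 (\<lambda>t. (a t)\<^sup>2) {0..1} \<and> C_k_on 1 b {0..1}"

definition std_gaussian :: "'a::euclidean_space measure" where
  "std_gaussian = density lborel (\<lambda>x. ennreal (\<Prod>i\<in>Basis. std_normal_density (x \<bullet> i)))"

definition interpolant ::
    "(real \<Rightarrow> real) \<Rightarrow> (real \<Rightarrow> real) \<Rightarrow> ('w \<Rightarrow> 'a) \<Rightarrow> ('w \<Rightarrow> 'a) \<Rightarrow> real \<Rightarrow> 'w \<Rightarrow> 'a::euclidean_space" where
  "interpolant a b Z X1 t \<omega> = a t *\<^sub>R Z \<omega> + b t *\<^sub>R X1 \<omega>"

definition interpolant_rate ::
    "(real \<Rightarrow> real) \<Rightarrow> (real \<Rightarrow> real) \<Rightarrow> ('w \<Rightarrow> 'a) \<Rightarrow> ('w \<Rightarrow> 'a) \<Rightarrow> real \<Rightarrow> 'w \<Rightarrow> 'a::euclidean_space" where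
  "interpolant_rate a b Z X1 t \<omega> = time_deriv a t *\<^sub>R Z \<omega> + time_deriv b t *\<^sub>R X1 \<omega>"

definition marginal_density ::
    "'w measure \<Rightarrow> (real \<Rightarrow> real) \<Rightarrow> (real \<Rightarrow> real) \<Rightarrow> ('w \<Rightarrow> 'a) \<Rightarrow> ('w \<Rightarrow> 'a) \<Rightarrow>
      real \<Rightarrow> 'a::euclidean_space \<Rightarrow> real" where
  "marginal_density M a b Z X1 t x =
     enn2real (RN_deriv lborel (distr M borel (interpolant a b Z X1 t)) x)"

text \<open>
  \<open>is_cond_mean M X Y g\<close>: the function \<open>g\<close> is a version of \<open>x \<mapsto> E[Y | X = x]\<close>, i.e.
  \<open>g \<circ> X\<close> is a version of the conditional expectation of \<open>Y\<close> given the sigma-algebra generated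
  by \<open>X\<close> (coordinatewise, as the library's conditional expectation is real-valued).
\<close>

definition is_cond_mean ::
    "'w measure \<Rightarrow> ('w \<Rightarrow> 'a) \<Rightarrow> ('w \<Rightarrow> 'a) \<Rightarrow> ('a::euclidean_space \<Rightarrow> 'a) \<Rightarrow> bool" where
  "is_cond_mean M X Y g \<longleftrightarrow> g \<in> borel_measurable borel \<and>
     (\<forall>i\<in>Basis. AE \<omega> in M.
        real_cond_exp M (vimage_algebra (space M) X borel) (\<lambda>\<omega>. Y \<omega> \<bullet> i) \<omega> = g (X \<omega>) \<bullet> i)"

text \<open>
  Versions agree only almost everywhere, so pointwise limits need a choice of version: we take the
  continuous one, of which there is at most one if the law of \<open>X\<close> has full support.
\<close>

definition cond_mean ::
    "'w measure \<Rightarrow> ('w \<Rightarrow> 'a) \<Rightarrow> ('w \<Rightarrow> 'a) \<Rightarrow> 'a::euclidean_space \<Rightarrow> 'a" where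
  "cond_mean M X Y = (THE g. continuous_on UNIV g \<and> is_cond_mean M X Y g)"

text \<open>
  The limit at time 1 need not exist without further regularity of the target: for
  \<open>a t = 1 - t\<close>, \<open>b t = t\<close> and the uniform distribution on \<open>[0, 1]\<close>, the velocity at \<open>x = 2\<close> is
  at most \<open>- 1 / (1 - t)\<close>. At such points \<open>Lim\<close> is unspecified.
\<close>

definition velocity ::
    "'w measure \<Rightarrow> (real \<Rightarrow> real) \<Rightarrow> (real \<Rightarrow> real) \<Rightarrow> ('w \<Rightarrow> 'a) \<Rightarrow> ('w \<Rightarrow> 'a) \<Rightarrow>
      real \<Rightarrow> 'a::euclidean_space \<Rightarrow> 'a" where
  "velocity M a b Z X1 t x =
     (let u = (\<lambda>s. cond_mean M (interpolant a b Z X1 s) (interpolant_rate a b Z X1 s) x)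
      in if t = 0 then Lim (at_right 0) u else if t = 1 then Lim (at_left 1) u else u t)"

text \<open>
  Integrand of the weak formulation, \<open>(\<partial>\<^sub>t \<phi> + \<langle>v, \<nabla>\<^sub>x \<phi>\<rangle>) p\<close>: the differential of \<open>\<phi> (t, _)\<close> at \<open>x\<close>
  applied to \<open>v t x\<close> is the inner product of \<open>v t x\<close> with the spatial gradient.
\<close>

definition weak_integrand ::
    "(real \<Rightarrow> 'a \<Rightarrow> real) \<Rightarrow> (real \<Rightarrow> 'a \<Rightarrow> 'a) \<Rightarrow> (real \<times> 'a \<Rightarrow> real) \<Rightarrow> real \<Rightarrow> 'a::euclidean_space \<Rightarrow> real"
  where
  "weak_integrand p v \<phi> t x =
     (deriv (\<lambda>s. \<phi> (s, x)) t + frechet_derivative (\<lambda>y. \<phi> (t, y)) (at x) (v t x)) * p t x"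

text \<open>
  Weak solutions on the closed time interval. Test functions need not vanish at times 0 and 1; the
  boundary terms express that \<open>p 0\<close> and \<open>p 1\<close> are attained as initial and terminal values. Test
  functions supported in the open strip give the equation in the sense of distributions.
  The integrability conditions ensure that no integral takes its default value.
\<close>

definition weak_continuity_equation ::
    "(real \<Rightarrow> 'a \<Rightarrow> real) \<Rightarrow> (real \<Rightarrow> 'a \<Rightarrow> 'a::euclidean_space) \<Rightarrow> bool" where
  "weak_continuity_equation p v \<longleftrightarrow>
     (\<lambda>(t, x). v t x) \<in> borel_measurable (restrict_space borel ({0<..<1} \<times> UNIV)) \<and>
     (\<forall>K. compact K \<longrightarrow>
        (\<integral>\<^sup>+t\<in>{0<..<1}. (\<integral>\<^sup>+x\<in>K. ennreal (norm (v t x) * p t x) \<partial>lborel) \<partial>lborel) < \<infinity>) \<and>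
     (\<forall>\<phi>. test_function \<phi> \<longrightarrow>
        (\<forall>t\<in>{0<..<1}. integrable lborel (weak_integrand p v \<phi> t)) \<and>
        set_integrable lborel {0<..<1} (\<lambda>t. LINT x|lborel. weak_integrand p v \<phi> t x) \<and>
        integrable lborel (\<lambda>x. \<phi> (0, x) * p 0 x) \<and> integrable lborel (\<lambda>x. \<phi> (1, x) * p 1 x) \<and>
        (LINT t:{0<..<1}|lborel. LINT x|lborel. weak_integrand p v \<phi> t x) =
          (LINT x|lborel. \<phi> (1, x) * p 1 x) - (LINT x|lborel. \<phi> (0, x) * p 0 x))"

end

theory Submission imports Defs begin

text \<open>
  The argument is Lagrangian. Along every path, \<open>\<phi> (t, X\<^sub>t)\<close> is differentiable on \<open>(0, 1)\<close>
  with derivative \<open>\<partial>\<^sub>t \<phi> (t, X\<^sub>t) + \<langle>\<nabla>\<phi> (t, X\<^sub>t), R\<^sub>t\<rangle>\<close>, where \<open>R\<^sub>t\<close> is the rate of the interpolation.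
  Integrating in time and taking expectations gives the boundary terms; conditioning on \<open>X\<^sub>t\<close>
  replaces \<open>R\<^sub>t\<close> by \<open>v (t, X\<^sub>t)\<close>. Fubini applies because \<open>a\<close> and \<open>b\<close> are monotone, so that their
  derivatives are integrable up to the end points, even where \<open>a\<close> is not differentiable.

  The continuous version of the conditional mean comes from Bayes' formula: for \<open>t < 1\<close> the pair
  \<open>(X\<^sub>t, X\<^sub>1)\<close> has a Gaussian density with respect to the product of Lebesgue measure and \<open>\<nu>\<close>. The
  resulting quotient of integrals is jointly continuous in time and space up to time 0 by
  dominated convergence, and positivity of the denominator makes it the only continuous version.
\<close>

section \<open>The standard Gaussian and its affine images\<close>

definition gauss_density :: "'a::euclidean_space \<Rightarrow> real" where
  "gauss_density x = (\<Prod>i\<in>Basis. std_normal_density (x \<bullet> i))"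

lemma continuous_on_std_normal_density [continuous_intros]:
  "continuous_on A f \<Longrightarrow> continuous_on A (\<lambda>x. std_normal_density (f x))"
  unfolding std_normal_density_def by (intro continuous_intros) auto

lemma std_normal_density_le_1: "std_normal_density x \<le> 1"
proof -
  have "1 / sqrt (2 * pi) \<le> 1" using pi_gt3 by simp
  then show ?thesis
    unfolding std_normal_density_def by (intro mult_le_one) auto
qed

text \<open>The elementary chain \<open>\<bar>x\<bar> \<le> 1 + x\<^sup>2 / 2 \<le> exp (x\<^sup>2 /
  2)\<close> lets the exponential absorb the linear factor.\<close>

lemma abs_mult_std_normal_density_le_1: "\<bar>x\<bar> * std_normal_density x \<le> 1"
proof -
  have 1: "1 / sqrt (2 * pi) \<le> 1" using pi_gt3 by simp
  have "0 \<le> (\<bar>x\<bar> - 1)\<^sup>2" by simp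
  then have "\<bar>x\<bar> \<le> 1 + x\<^sup>2 / 2" by (simp add: power2_diff)
  also have "\<dots> \<le> exp (x\<^sup>2 / 2)" by (rule exp_ge_add_one_self)
  finally have 2: "\<bar>x\<bar> * exp (- x\<^sup>2 / 2) \<le> 1" by (simp add: exp_minus divide_simps)
  have "\<bar>x\<bar> * std_normal_density x = (1 / sqrt (2 * pi)) * (\<bar>x\<bar> * exp (- x\<^sup>2 / 2))"
    unfolding std_normal_density_def by simp
  also have "\<dots> \<le> 1" by (rule mult_le_one) (use 1 2 in auto)
  finally show ?thesis .
qed

lemma continuous_on_gauss_density [continuous_intros]:
  "continuous_on A f \<Longrightarrow> continuous_on A (\<lambda>x. gauss_density (f x))"
  unfolding gauss_density_def by (intro continuous_intros)

lemma borel_measurable_gauss_density [measurable]: "gauss_density \<in> borel_measurable borel"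
  by (intro borel_measurable_continuous_onI continuous_intros)

lemma gauss_density_pos: "gauss_density x > 0"
  unfolding gauss_density_def by (intro prod_pos) (simp add: normal_density_pos)

lemma gauss_density_le_1: "gauss_density x \<le> 1"
  unfolding gauss_density_def by (intro prod_le_1) (simp add: std_normal_density_le_1)

text \<open>Splitting off the factor of index \<open>i\<close> leaves the one-dimensional bound
  times factors at most 1. Both kernels in Bayes' formula, with and without the factor
  \<open>z \<bullet> i\<close>, thus have the same bound 1, and one dominated convergence argument
  covers them.\<close>

lemma abs_inner_mult_gauss_density_le_1:
  assumes "i \<in> Basis"
  shows "\<bar>x \<bullet> i\<bar> * gauss_density x \<le> 1"
proof -
  have "\<bar>x \<bullet> i\<bar> * gauss_density x =
      (\<bar>x \<bullet> i\<bar> * std_normal_density (x \<bullet> i)) * (\<Prod>j\<in>Basis - {i}. std_normal_density (x \<bullet> j))"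
    unfolding gauss_density_def using assms by (subst prod.remove[of _ i]) auto
  also have "\<dots> \<le> 1"
    by (intro mult_le_one abs_mult_std_normal_density_le_1 prod_le_1 prod_nonneg)
      (simp_all add: std_normal_density_le_1)
  finally show ?thesis .
qed

lemma std_gaussian_eq: "std_gaussian = density lborel (\<lambda>x. ennreal (gauss_density x))"
  unfolding std_gaussian_def gauss_density_def ..

lemma prob_space_std_gaussian: "prob_space (std_gaussian :: 'a::euclidean_space measure)"
proof
  have "emeasure std_gaussian (space (std_gaussian :: 'a measure)) =
      (\<integral>\<^sup>+z. (\<Prod>i\<in>Basis. ennreal (std_normal_density (z \<bullet> i))) \<partial>(lborel :: 'a measure))"
    unfolding std_gaussian_eq by (simp add: emeasure_density gauss_density_def prod_ennreal)
  also have "\<dots> = (\<Prod>i\<in>(Basis :: 'a set). \<integral>\<^sup>+s. ennreal (std_normal_density s) \<partial>lborel)"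
    by (rule nn_integral_lborel_prod) simp_all
  also have "(\<integral>\<^sup>+s. ennreal (std_normal_density s) \<partial>lborel) = 1"
    using integrable_normal_density[of 1 0] integral_normal_density[of 1 0]
    by (subst nn_integral_eq_integral) auto
  finally show "emeasure std_gaussian (space (std_gaussian :: 'a measure)) = 1" by simp
qed

lemma integrable_inner_std_gaussian:
  assumes i: "i \<in> Basis"
  shows "integrable std_gaussian (\<lambda>z::'a::euclidean_space. z \<bullet> i)"
proof -
  \<comment> \<open>The weight \<open>\<bar>s\<bar>\<close> sits in coordinate \<open>i\<close>
    only, so the integrand is again a product over coordinates: one first absolute moment times
    total masses.\<close>
  let ?f = "\<lambda>j s. std_normal_density s * (if j = i then \<bar>s\<bar> else 1)"
  have eq: "norm (gauss_density z * (z \<bullet> i)) = (\<Prod>j\<in>Basis. ?f j (z \<bullet> j))" for z :: 'a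
    using i by (simp add: gauss_density_def prod.distrib abs_mult abs_prod)
  have "(\<integral>\<^sup>+z. ennreal (norm (gauss_density z * (z \<bullet> i))) \<partial>(lborel :: 'a measure)) =
      (\<Prod>j\<in>Basis. \<integral>\<^sup>+s. ennreal (?f j s) \<partial>lborel)"
    unfolding eq by (subst prod_ennreal[symmetric], simp) (rule nn_integral_lborel_prod; simp)
  also have "\<dots> < \<infinity>"
  proof -
    have "(\<integral>\<^sup>+s. ennreal (?f j s) \<partial>lborel) < \<infinity>" for j
    proof -
      have "integrable lborel (?f j)"
        using integrable_std_normal_moment_abs[of 1] integrable_std_normal_moment[of 0] by (cases "j = i") auto
      then show ?thesis by (simp add: integrable_iff_bounded)
    qed
    then show ?thesis by (auto simp: less_top[symmetric] ennreal_prod_eq_top)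
  qed
  finally have "integrable lborel (\<lambda>z::'a. gauss_density z * (z \<bullet> i))"
    by (simp add: integrable_iff_bounded)
  then show ?thesis
    unfolding std_gaussian_eq
    by (subst integrable_real_density) (auto intro: less_imp_le[OF gauss_density_pos])
qed

section \<open>Change of variables and the joint law of position and endpoint\<close>

lemma nn_integral_lborel_affine:
  fixes m :: "'a::euclidean_space"
  assumes [measurable]: "f \<in> borel_measurable borel" and c: "c \<noteq> 0"
  shows "(\<integral>\<^sup>+z. f (m + c *\<^sub>R z) \<partial>lborel) = (\<integral>\<^sup>+x. f x / ennreal (\<bar>c\<bar> ^ DIM('a)) \<partial>lborel)"
proof -
  have "(\<integral>\<^sup>+x. f x / ennreal (\<bar>c\<bar> ^ DIM('a)) \<partial>lborel) =
      (\<integral>\<^sup>+z. ennreal (\<bar>c\<bar> ^ DIM('a)) * (f (m + c *\<^sub>R z) / ennreal (\<bar>c\<bar> ^ DIM('a))) \<partial>lborel)"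
    by (subst lborel_affine[OF c, of m])
      (simp add: nn_integral_density nn_integral_distr c ennreal_power)
  also have "\<dots> = (\<integral>\<^sup>+z. f (m + c *\<^sub>R z) \<partial>lborel)"
  proof (intro nn_integral_cong)
    fix z
    have "ennreal (\<bar>c\<bar> ^ DIM('a)) * (f (m + c *\<^sub>R z) / ennreal (\<bar>c\<bar> ^ DIM('a))) =
      f (m + c *\<^sub>R z) * (ennreal (\<bar>c\<bar> ^ DIM('a)) / ennreal (\<bar>c\<bar> ^ DIM('a)))"
      by (simp add: ennreal_times_divide mult.commute)
    then show "ennreal (\<bar>c\<bar> ^ DIM('a)) * (f (m + c *\<^sub>R z) / ennreal (\<bar>c\<bar> ^ DIM('a))) = f (m + c *\<^sub>R z)"
      using c by (simp add: divide_ennreal)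
  qed
  finally show ?thesis ..
qed

text \<open>For \<alpha> > 0 and fixed \<open>y\<close> this is, in \<open>x\<close>, the density of
  the normal law with mean \<open>\<beta> *\<^sub>R y\<close> and covariance \<alpha> squared times
  the identity, that is, of the position given the endpoint. The paired argument makes it a density
  on a product space.\<close>

definition noise_kernel :: "real \<Rightarrow> real \<Rightarrow> 'a::euclidean_space \<times> 'a \<Rightarrow> real" where
  "noise_kernel \<alpha> \<beta> = (\<lambda>(x, y). gauss_density ((x - \<beta> *\<^sub>R y) /\<^sub>R \<alpha>) / \<alpha> ^ DIM('a))"

lemma borel_measurable_noise_kernel [measurable]:
  "noise_kernel \<alpha> \<beta> \<in> borel_measurable (borel \<Otimes>\<^sub>M borel)"
  unfolding noise_kernel_def by measurable

lemma noise_kernel_pos: "\<alpha> > 0 \<Longrightarrow> noise_kernel \<alpha> \<beta> z > 0"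
  unfolding noise_kernel_def by (auto simp: gauss_density_pos split: prod.split)

lemma noise_kernel_nonneg: "\<alpha> > 0 \<Longrightarrow> noise_kernel \<alpha> \<beta> z \<ge> 0"
  using noise_kernel_pos less_imp_le by blast

text \<open>Fubini freezes the endpoint \<open>y\<close>. The position is then an affine image of
  the noise, and the change of variables turns the Gaussian density into the kernel. This explains
  the mixed reference measure: Lebesgue for the position, \<nu> for the endpoint.\<close>

lemma distr_gaussian_interpolation:
  fixes \<nu> :: "'a::euclidean_space measure"
  assumes "prob_space \<nu>" and [measurable_cong, simp]: "sets \<nu> = sets borel" and \<alpha>: "\<alpha> > 0"
  shows "distr (std_gaussian \<Otimes>\<^sub>M \<nu>) (borel \<Otimes>\<^sub>M borel) (\<lambda>(z, y). (\<alpha> *\<^sub>R z + \<beta> *\<^sub>R y, y)) =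
    density (lborel \<Otimes>\<^sub>M \<nu>) (noise_kernel \<alpha> \<beta>)"
proof (rule measure_eqI)
  interpret \<nu>: prob_space \<nu> by fact
  have [measurable_cong]: "sets std_gaussian = sets (borel :: 'a measure)"
    by (simp add: std_gaussian_def)
  interpret G: prob_space "std_gaussian :: 'a measure" by (rule prob_space_std_gaussian)
  interpret P: pair_sigma_finite "std_gaussian :: 'a measure" \<nu> ..
  interpret Q: pair_sigma_finite "lborel :: 'a measure" \<nu> ..
  fix A assume A: "A \<in> sets (distr (std_gaussian \<Otimes>\<^sub>M \<nu>) (borel \<Otimes>\<^sub>M borel) (\<lambda>(z, y). (\<alpha> *\<^sub>R z + \<beta> *\<^sub>R y, y)))"
  then have A'[measurable]: "A \<in> sets (borel \<Otimes>\<^sub>M borel)" by simp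
  have "emeasure (distr (std_gaussian \<Otimes>\<^sub>M \<nu>) (borel \<Otimes>\<^sub>M borel) (\<lambda>(z, y). (\<alpha> *\<^sub>R z + \<beta> *\<^sub>R y, y))) A =
     (\<integral>\<^sup>+w. indicator A w \<partial>distr (std_gaussian \<Otimes>\<^sub>M \<nu>) (borel \<Otimes>\<^sub>M borel) (\<lambda>(z, y). (\<alpha> *\<^sub>R z + \<beta> *\<^sub>R y, y)))"
    using A by simp
  also have "\<dots> = (\<integral>\<^sup>+(z, y). indicator A (\<alpha> *\<^sub>R z + \<beta> *\<^sub>R y, y) \<partial>(std_gaussian \<Otimes>\<^sub>M \<nu>))"
    by (subst nn_integral_distr) (auto simp: case_prod_beta')
  also have "\<dots> = (\<integral>\<^sup>+y. \<integral>\<^sup>+z. indicator A (\<alpha> *\<^sub>R z + \<beta> *\<^sub>R y, y) \<partial>std_gaussian \<partial>\<nu>)"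
    by (subst P.nn_integral_snd[symmetric]) auto
  also have "\<dots> = (\<integral>\<^sup>+y. \<integral>\<^sup>+x. ennreal (noise_kernel \<alpha> \<beta> (x, y)) * indicator A (x, y) \<partial>lborel \<partial>\<nu>)"
  proof (intro nn_integral_cong)
    fix y
    have [measurable]: "(\<lambda>z::'a. (\<alpha> *\<^sub>R z + \<beta> *\<^sub>R y, y)) \<in> borel \<rightarrow>\<^sub>M borel \<Otimes>\<^sub>M borel" by measurable
    have "(\<integral>\<^sup>+z. indicator A (\<alpha> *\<^sub>R z + \<beta> *\<^sub>R y, y) \<partial>std_gaussian) =
      (\<integral>\<^sup>+z. ennreal (gauss_density z) * indicator A (\<alpha> *\<^sub>R z + \<beta> *\<^sub>R y, y) \<partial>lborel)"
      unfolding std_gaussian_eq by (subst nn_integral_density) auto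
    also have "\<dots> = (\<integral>\<^sup>+z. (\<lambda>x. ennreal (gauss_density ((x - \<beta> *\<^sub>R y) /\<^sub>R \<alpha>)) * indicator A (x, y)) (\<beta> *\<^sub>R y + \<alpha> *\<^sub>R z) \<partial>lborel)"
      using \<alpha> by (simp add: add.commute)
    also have "\<dots> = (\<integral>\<^sup>+x. ennreal (gauss_density ((x - \<beta> *\<^sub>R y) /\<^sub>R \<alpha>)) * indicator A (x, y) / ennreal (\<bar>\<alpha>\<bar> ^ DIM('a)) \<partial>lborel)"
      using \<alpha> by (subst nn_integral_lborel_affine) auto
    also have "\<dots> = (\<integral>\<^sup>+x. ennreal (noise_kernel \<alpha> \<beta> (x, y)) * indicator A (x, y) \<partial>lborel)"
      using \<alpha> by (intro nn_integral_cong)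
        (auto simp: noise_kernel_def divide_ennreal less_imp_le[OF gauss_density_pos] split: split_indicator)
    finally show "(\<integral>\<^sup>+z. indicator A (\<alpha> *\<^sub>R z + \<beta> *\<^sub>R y, y) \<partial>std_gaussian) = \<dots>" .
  qed
  also have "\<dots> = (\<integral>\<^sup>+w. ennreal (noise_kernel \<alpha> \<beta> w) * indicator A w \<partial>(lborel \<Otimes>\<^sub>M \<nu>))"
    by (subst Q.nn_integral_snd[symmetric]) auto
  also have "\<dots> = emeasure (density (lborel \<Otimes>\<^sub>M \<nu>) (noise_kernel \<alpha> \<beta>)) A"
    by (subst emeasure_density) auto
  finally show "emeasure (distr (std_gaussian \<Otimes>\<^sub>M \<nu>) (borel \<Otimes>\<^sub>M borel) (\<lambda>(z, y). (\<alpha> *\<^sub>R z + \<beta> *\<^sub>R y, y))) A = \<dots>" .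
qed simp

section \<open>Conditional means at a fixed time\<close>

text \<open>The common shape of numerator and denominator in Bayes' formula: \<open>H\<close> is
  evaluated at the noise that leads from endpoint \<open>y\<close> to position \<open>x\<close>. The
  parameters form one tuple so that joint continuity can be stated with
  \<open>continuous_on\<close>.\<close>

definition kernel_mean ::
    "'a::euclidean_space measure \<Rightarrow> ('a \<Rightarrow> real) \<Rightarrow> ('a \<Rightarrow> real) \<Rightarrow> real \<times> real \<times> 'a \<Rightarrow> real" where
  "kernel_mean \<nu> H w = (\<lambda>(\<alpha>, \<beta>, x). LINT y|\<nu>. H ((x - \<beta> *\<^sub>R y) /\<^sub>R \<alpha>) * w y)"

lemma integrable_bounded_kernel_mult:
  fixes H :: "'a::euclidean_space \<Rightarrow> real" and x :: 'a
  assumes [measurable_cong]: "sets \<nu> = sets borel" and [measurable]: "H \<in> borel_measurable borel"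
    and H: "\<And>z. \<bar>H z\<bar> \<le> 1" and w: "integrable \<nu> w"
  shows "integrable \<nu> (\<lambda>y. H ((x - \<beta> *\<^sub>R y) /\<^sub>R \<alpha>) * w y)"
proof (rule Bochner_Integration.integrable_bound[OF w])
  have [measurable]: "w \<in> borel_measurable borel"
    using borel_measurable_integrable[OF w] by (simp cong: measurable_cong_sets add: assms)
  show "(\<lambda>y. H ((x - \<beta> *\<^sub>R y) /\<^sub>R \<alpha>) * w y) \<in> borel_measurable \<nu>" by measurable
qed (auto simp: abs_mult intro!: AE_I2 mult_left_le_one_le H)

text \<open>Dominated convergence along sequences: since \<open>H\<close> is bounded by 1,
  \<open>norm (w y)\<close> dominates for all parameters at once. Positivity of \<alpha> matters at
  the limit point, where the division has to be continuous.\<close>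

lemma continuous_on_kernel_mean:
  fixes \<nu> :: "'a::euclidean_space measure"
  assumes sets_nu: "sets \<nu> = sets borel" and H: "continuous_on UNIV H" "\<And>z. \<bar>H z\<bar> \<le> 1"
    and w: "integrable \<nu> w"
  shows "continuous_on ({0<..} \<times> UNIV) (kernel_mean \<nu> H w)"
proof -
  have [measurable]: "H \<in> borel_measurable borel"
    by (rule borel_measurable_continuous_onI[OF H(1)])
  have lim: "(\<lambda>n. kernel_mean \<nu> H w (s n)) \<longlonglongrightarrow> kernel_mean \<nu> H w l"
    if s: "s \<longlonglongrightarrow> l" and l: "l \<in> {0<..} \<times> UNIV" for s :: "nat \<Rightarrow> real \<times> real \<times> 'a" and l
  proof -
    have l0: "fst l \<noteq> 0" using l by auto
    show ?thesis unfolding kernel_mean_def case_prod_beta'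
    proof (rule integral_dominated_convergence[where w="\<lambda>y. norm (w y)"])
      have "(\<lambda>n. H ((snd (snd (s n)) - fst (snd (s n)) *\<^sub>R y) /\<^sub>R fst (s n)))
          \<longlonglongrightarrow> H ((snd (snd l) - fst (snd l) *\<^sub>R y) /\<^sub>R fst l)" for y
        by (rule continuous_on_tendsto_compose[OF H(1)]) (use l0 in \<open>auto intro!: tendsto_intros s\<close>)
      then show "AE y in \<nu>. (\<lambda>n. H ((snd (snd (s n)) - fst (snd (s n)) *\<^sub>R y) /\<^sub>R fst (s n)) * w y)
          \<longlonglongrightarrow> H ((snd (snd l) - fst (snd l) *\<^sub>R y) /\<^sub>R fst l) * w y"
        by (auto intro!: tendsto_mult)
      show "integrable \<nu> (\<lambda>y. norm (w y))" using w by (rule integrable_norm)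
      show "(\<lambda>y. H ((snd (snd r) - fst (snd r) *\<^sub>R y) /\<^sub>R fst r) * w y) \<in> borel_measurable \<nu>"
        for r :: "real \<times> real \<times> 'a"
        by (rule borel_measurable_integrable, rule integrable_bounded_kernel_mult) (use assms in auto)
      then show "(\<lambda>y. H ((snd (snd (s n)) - fst (snd (s n)) *\<^sub>R y) /\<^sub>R fst (s n)) * w y)
          \<in> borel_measurable \<nu>" for n .
    qed (auto simp: abs_mult intro!: AE_I2 mult_left_le_one_le H(2))
  qed
  show ?thesis
    unfolding continuous_on_sequentially comp_def using lim by blast
qed

text \<open>
  Bayes' formula for \<open>E[\<alpha>' Z + \<beta>' X1 | \<alpha> Z + \<beta> X1 = x]\<close> at \<open>w = (\<alpha>, \<beta>, x)\<close>: given also \<open>X1 = y\<close>, the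
  noise is \<open>Z = (x - \<beta> y) / \<alpha>\<close>, and the common factor \<open>\<alpha> ^ DIM('a)\<close> cancels.
\<close>

definition cond_velocity ::
    "'a::euclidean_space measure \<Rightarrow> real \<Rightarrow> real \<Rightarrow> real \<times> real \<times> 'a \<Rightarrow> 'a" where
  "cond_velocity \<nu> \<alpha>' \<beta>' w = (\<Sum>i\<in>Basis.
     ((\<alpha>' * kernel_mean \<nu> (\<lambda>z. (z \<bullet> i) * gauss_density z) (\<lambda>_. 1) w
       + \<beta>' * kernel_mean \<nu> gauss_density (\<lambda>y. y \<bullet> i) w)
      / kernel_mean \<nu> gauss_density (\<lambda>_. 1) w) *\<^sub>R i)"

text \<open>The set where two continuous functions differ is open; being null as well, it is
  empty.\<close>

lemma AE_lborel_eq_imp_eq: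
  fixes f g :: "'a::euclidean_space \<Rightarrow> 'b::real_normed_vector"
  assumes "continuous_on UNIV f" "continuous_on UNIV g" "AE x in lborel. f x = g x"
  shows "f = g"
proof -
  have "open {x. f x \<noteq> g x}"
    by (rule open_Collect_neq) (use assms in auto)
  moreover have "{x. f x \<noteq> g x} \<in> null_sets lborel"
    using assms(3) calculation by (subst AE_iff_null_sets) auto
  then have "negligible {x. f x \<noteq> g x}"
    by (metis negligible_iff_null_sets null_sets_completionI)
  ultimately have "{x. f x \<noteq> g x} = {}"
    using open_not_negligible by blast
  then show ?thesis by auto
qed

section \<open>Independent noise and endpoint: densities and Bayes' formula\<close>

locale gaussian_interpolation = prob_space M
  for M :: "'w measure" and Z X1 :: "'w \<Rightarrow> 'a::euclidean_space" and \<nu> :: "'a measure" +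
  assumes meas_Z [measurable]: "Z \<in> borel_measurable M"
    and meas_X1 [measurable]: "X1 \<in> borel_measurable M"
    and distr_Z: "distr M borel Z = std_gaussian"
    and distr_X1: "distr M borel X1 = \<nu>"
    and indep: "indep_var borel Z borel X1"
    and integrable_X1: "integrable M X1"
begin

lemma sets_nu [simp, measurable_cong]: "sets \<nu> = sets borel"
  and space_nu [simp]: "space \<nu> = UNIV"
  using distr_X1 by (metis sets_distr, metis space_distr space_borel)

lemma prob_space_nu: "prob_space \<nu>"
  using prob_space_distr[OF meas_X1] distr_X1 by simp

sublocale \<nu>: prob_space \<nu> by (rule prob_space_nu)
sublocale Q: pair_sigma_finite "lborel :: 'a measure" \<nu> ..

lemma integrable_inner_nu: "integrable \<nu> (\<lambda>y. y \<bullet> i)"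
proof -
  have "integrable M (\<lambda>\<omega>. X1 \<omega> \<bullet> i)" using integrable_X1 by simp
  then show ?thesis unfolding distr_X1[symmetric] by (subst integrable_distr_eq) auto
qed

lemma integrable_inner_Z: "i \<in> Basis \<Longrightarrow> integrable M (\<lambda>\<omega>. Z \<omega> \<bullet> i)"
  using integrable_inner_std_gaussian[of i] unfolding distr_Z[symmetric]
  by (subst (asm) integrable_distr_eq) auto

lemma continuous_on_gauss_means:
  "continuous_on ({0<..} \<times> UNIV) (kernel_mean \<nu> gauss_density (\<lambda>_. 1))"
  "continuous_on ({0<..} \<times> UNIV) (kernel_mean \<nu> gauss_density (\<lambda>y. y \<bullet> i))"
  "i \<in> Basis \<Longrightarrow>
    continuous_on ({0<..} \<times> UNIV) (kernel_mean \<nu> (\<lambda>z. (z \<bullet> i) * gauss_density z) (\<lambda>_. 1))"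
  by (auto intro!: continuous_on_kernel_mean continuous_intros integrable_inner_nu
      abs_inner_mult_gauss_density_le_1 gauss_density_le_1
      simp: abs_mult abs_of_pos[OF gauss_density_pos])

text \<open>The integral of a strictly positive function against a probability measure vanishes only
  if the function is zero almost everywhere. This covers \<alpha> = 0 too: division by zero sends
  the argument of the Gaussian to 0, where it is positive.\<close>

lemma gauss_mean_pos: "kernel_mean \<nu> gauss_density (\<lambda>_. 1) w > 0"
proof -
  obtain \<alpha> \<beta> x where w: "w = (\<alpha>, \<beta>, x)" by (cases w)
  let ?f = "\<lambda>y. gauss_density ((x - \<beta> *\<^sub>R y) /\<^sub>R \<alpha>) * 1"
  have int: "integrable \<nu> ?f"
    by (rule integrable_bounded_kernel_mult)
      (auto simp: abs_of_pos[OF gauss_density_pos] gauss_density_le_1)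
  have "(LINT y|\<nu>. ?f y) \<noteq> 0"
    using int by (subst integral_nonneg_eq_0_iff_AE)
      (auto simp: gauss_density_pos less_imp_le less_imp_neq[symmetric] \<nu>.AE_False)
  moreover have "(LINT y|\<nu>. ?f y) \<ge> 0"
    by (intro Bochner_Integration.integral_nonneg) (auto simp: gauss_density_pos less_imp_le)
  ultimately show ?thesis unfolding w kernel_mean_def by simp
qed

text \<open>The parameters vary over an arbitrary topological space so that one statement yields
  continuity in space at a fixed time, the limit at time 0, and joint measurability on the open
  strip.\<close>

lemma continuous_on_cond_velocity:
  fixes \<alpha>' \<beta>' \<alpha> \<beta> :: "'t::topological_space \<Rightarrow> real" and x :: "'t \<Rightarrow> 'a"
  assumes "continuous_on S \<alpha>'" "continuous_on S \<beta>'" "continuous_on S \<alpha>" "continuous_on S \<beta>"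
    "continuous_on S x" and pos: "\<And>t. t \<in> S \<Longrightarrow> \<alpha> t > 0"
  shows "continuous_on S (\<lambda>t. cond_velocity \<nu> (\<alpha>' t) (\<beta>' t) (\<alpha> t, \<beta> t, x t))"
proof -
  have comp: "continuous_on S (\<lambda>t. k (\<alpha> t, \<beta> t, x t))"
    if "continuous_on ({0<..} \<times> UNIV) k" for k :: "real \<times> real \<times> 'a \<Rightarrow> real"
    by (rule continuous_on_compose2[OF that]) (use assms in \<open>auto intro!: continuous_intros\<close>)
  show ?thesis unfolding cond_velocity_def
    by (intro continuous_intros comp continuous_on_gauss_means assms(1,2))
      (use gauss_mean_pos in \<open>auto simp: less_imp_neq[symmetric]\<close>)
qed

text \<open>Independence makes the law of \<open>(Z, X1)\<close> a product measure, whose image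
  under the interpolation map has already been computed.\<close>

lemma distributed_joint:
  assumes \<alpha>: "\<alpha> > 0"
  shows "distributed M (lborel \<Otimes>\<^sub>M \<nu>) (\<lambda>\<omega>. (\<alpha> *\<^sub>R Z \<omega> + \<beta> *\<^sub>R X1 \<omega>, X1 \<omega>))
    (\<lambda>w. ennreal (noise_kernel \<alpha> \<beta> w))"
proof -
  have *: "distr M (borel \<Otimes>\<^sub>M borel) (\<lambda>\<omega>. (Z \<omega>, X1 \<omega>)) = std_gaussian \<Otimes>\<^sub>M \<nu>"
    using indep unfolding indep_var_distribution_eq by (simp add: distr_Z distr_X1)
  have "distr M (lborel \<Otimes>\<^sub>M \<nu>) (\<lambda>\<omega>. (\<alpha> *\<^sub>R Z \<omega> + \<beta> *\<^sub>R X1 \<omega>, X1 \<omega>)) =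
      distr M (borel \<Otimes>\<^sub>M borel) (\<lambda>\<omega>. (\<alpha> *\<^sub>R Z \<omega> + \<beta> *\<^sub>R X1 \<omega>, X1 \<omega>))"
    by (intro distr_cong sets_pair_measure_cong) auto
  also have "\<dots> = distr (distr M (borel \<Otimes>\<^sub>M borel) (\<lambda>\<omega>. (Z \<omega>, X1 \<omega>))) (borel \<Otimes>\<^sub>M borel)
      (\<lambda>(z, y). (\<alpha> *\<^sub>R z + \<beta> *\<^sub>R y, y))"
    by (subst distr_distr) (auto simp: comp_def)
  also have "\<dots> = density (lborel \<Otimes>\<^sub>M \<nu>) (\<lambda>w. ennreal (noise_kernel \<alpha> \<beta> w))"
    unfolding * by (rule distr_gaussian_interpolation[OF prob_space_nu sets_nu \<alpha>])
  finally show ?thesis unfolding distributed_def by auto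
qed

lemma integrable_noise_kernel:
  fixes x :: 'a
  shows "\<alpha> > 0 \<Longrightarrow> integrable \<nu> (\<lambda>y. noise_kernel \<alpha> \<beta> (x, y))"
  using integrable_bounded_kernel_mult[OF sets_nu, where H = gauss_density and w = "\<lambda>_. 1"]
  by (simp add: noise_kernel_def abs_of_pos[OF gauss_density_pos] gauss_density_le_1)

text \<open>Integrating out the endpoint shows that the denominator of Bayes' formula is the density
  of the position up to the factor \<open>\<alpha> ^ DIM('a)\<close>. Its positivity therefore means
  that the law of the position has full support.\<close>

lemma distributed_interpolation:
  assumes \<alpha>: "\<alpha> > 0"
  shows "distributed M lborel (\<lambda>\<omega>. \<alpha> *\<^sub>R Z \<omega> + \<beta> *\<^sub>R X1 \<omega>)
    (\<lambda>x. ennreal (kernel_mean \<nu> gauss_density (\<lambda>_. 1) (\<alpha>, \<beta>, x) / \<alpha> ^ DIM('a)))"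
proof -
  have "distributed M lborel (\<lambda>\<omega>. \<alpha> *\<^sub>R Z \<omega> + \<beta> *\<^sub>R X1 \<omega>)
      (\<lambda>x. \<integral>\<^sup>+y. ennreal (noise_kernel \<alpha> \<beta> (x, y)) \<partial>\<nu>)"
    by (rule distr_marginal1[OF _ _ distributed_joint[OF \<alpha>]])
      (auto intro: lborel.sigma_finite_measure_axioms \<nu>.sigma_finite_measure_axioms)
  also have "(\<lambda>x. \<integral>\<^sup>+y. ennreal (noise_kernel \<alpha> \<beta> (x, y)) \<partial>\<nu>) =
      (\<lambda>x. ennreal (kernel_mean \<nu> gauss_density (\<lambda>_. 1) (\<alpha>, \<beta>, x) / \<alpha> ^ DIM('a)))"
    using \<alpha> by (auto simp: nn_integral_eq_integral integrable_noise_kernel noise_kernel_nonneg)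
      (simp add: noise_kernel_def kernel_mean_def)
  finally show ?thesis .
qed

text \<open>Bayes' formula before the division: the rate, written through position and endpoint, is
  averaged over the endpoint with the joint density, and the result is the marginal density times
  the conditional mean.\<close>

lemma integral_noise_kernel_rate:
  assumes \<alpha>: "\<alpha> > 0" and i: "i \<in> Basis"
  shows "(LINT y|\<nu>. noise_kernel \<alpha> \<beta> (x, y) * (\<alpha>' * (((x - \<beta> *\<^sub>R y) /\<^sub>R \<alpha>) \<bullet> i) + \<beta>' * (y \<bullet> i))) =
    kernel_mean \<nu> gauss_density (\<lambda>_. 1) (\<alpha>, \<beta>, x) / \<alpha> ^ DIM('a) *
      (cond_velocity \<nu> \<alpha>' \<beta>' (\<alpha>, \<beta>, x) \<bullet> i)"
proof -
  let ?z = "\<lambda>y. (x - \<beta> *\<^sub>R y) /\<^sub>R \<alpha>"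
  have int: "integrable \<nu> (\<lambda>y. (\<lambda>z. (z \<bullet> i) * gauss_density z) (?z y) * 1)"
      "integrable \<nu> (\<lambda>y. gauss_density (?z y) * (y \<bullet> i))"
    by (rule integrable_bounded_kernel_mult;
        simp add: abs_mult abs_of_pos[OF gauss_density_pos] gauss_density_le_1
          abs_inner_mult_gauss_density_le_1 i integrable_inner_nu)+
  have "(LINT y|\<nu>. noise_kernel \<alpha> \<beta> (x, y) * (\<alpha>' * (?z y \<bullet> i) + \<beta>' * (y \<bullet> i))) =
    (LINT y|\<nu>. (\<alpha>' / \<alpha> ^ DIM('a)) * ((\<lambda>z. (z \<bullet> i) * gauss_density z) (?z y) * 1) +
       (\<beta>' / \<alpha> ^ DIM('a)) * (gauss_density (?z y) * (y \<bullet> i)))"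
    by (intro Bochner_Integration.integral_cong) (simp_all add: noise_kernel_def distrib_left add_divide_distrib mult_ac)
  also have "\<dots> = (\<alpha>' / \<alpha> ^ DIM('a)) * kernel_mean \<nu> (\<lambda>z. (z \<bullet> i) * gauss_density z) (\<lambda>_. 1) (\<alpha>, \<beta>, x)
      + (\<beta>' / \<alpha> ^ DIM('a)) * kernel_mean \<nu> gauss_density (\<lambda>y. y \<bullet> i) (\<alpha>, \<beta>, x)"
    using int unfolding kernel_mean_def by (subst Bochner_Integration.integral_add) simp_all
  also have "\<dots> = kernel_mean \<nu> gauss_density (\<lambda>_. 1) (\<alpha>, \<beta>, x) / \<alpha> ^ DIM('a) *
      (cond_velocity \<nu> \<alpha>' \<beta>' (\<alpha>, \<beta>, x) \<bullet> i)"
    using i \<alpha> gauss_mean_pos[of "(\<alpha>, \<beta>, x)"] by (simp add: cond_velocity_def field_simps)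
  finally show ?thesis .
qed

section \<open>The conditional mean of the rate \<open>Y\<close> given the position
  \<open>U\<close>\<close>

context
  fixes \<alpha> \<beta> \<alpha>' \<beta>' :: real and U Y :: "'w \<Rightarrow> 'a" and V :: "'a \<Rightarrow> 'a"
  assumes \<alpha>: "\<alpha> > 0"
  defines "U \<equiv> \<lambda>\<omega>. \<alpha> *\<^sub>R Z \<omega> + \<beta> *\<^sub>R X1 \<omega>"
    and "Y \<equiv> \<lambda>\<omega>. \<alpha>' *\<^sub>R Z \<omega> + \<beta>' *\<^sub>R X1 \<omega>"
    and "V \<equiv> \<lambda>x. cond_velocity \<nu> \<alpha>' \<beta>' (\<alpha>, \<beta>, x)"
begin

lemma continuous_on_V: "continuous_on UNIV V"
  unfolding V_def by (rule continuous_on_cond_velocity) (auto intro: continuous_intros simp: \<alpha>)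

lemma borel_measurable_V [measurable]: "V \<in> borel_measurable borel"
  by (rule borel_measurable_continuous_onI[OF continuous_on_V])

lemma borel_measurable_UY [measurable]: "U \<in> borel_measurable M" "Y \<in> borel_measurable M"
  unfolding U_def Y_def by auto

lemma integrable_inner_Y: "i \<in> Basis \<Longrightarrow> integrable M (\<lambda>\<omega>. Y \<omega> \<bullet> i)"
  unfolding Y_def using integrable_X1 by (simp add: inner_add_left integrable_inner_Z)

text \<open>The defining identity of a conditional expectation, tested on the event that the
  position lies in \<open>B\<close>. Both expectations become integrals against densities, and
  Fubini over the endpoint links them.\<close>

lemma expectation_rate_indicator:
  assumes i: "i \<in> Basis" and B [measurable]: "B \<in> sets borel"
  shows "integrable M (\<lambda>\<omega>. indicator B (U \<omega>) * (V (U \<omega>) \<bullet> i))"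
    and "(LINT \<omega>|M. indicator B (U \<omega>) * (Y \<omega> \<bullet> i)) =
      (LINT \<omega>|M. indicator B (U \<omega>) * (V (U \<omega>) \<bullet> i))"
proof -
  \<comment> \<open>Solving the equation for \<open>U\<close> for the noise expresses the rate
    through the pair of position and endpoint, whose joint density is known.\<close>
  define h :: "'a \<times> 'a \<Rightarrow> real" where "h = (\<lambda>(x, y). indicator B x *
    (\<alpha>' * (((x - \<beta> *\<^sub>R y) /\<^sub>R \<alpha>) \<bullet> i) + \<beta>' * (y \<bullet> i)))"
  define q where "q x = kernel_mean \<nu> gauss_density (\<lambda>_. 1) (\<alpha>, \<beta>, x) / \<alpha> ^ DIM('a)" for x
  have [measurable]: "h \<in> borel_measurable (lborel \<Otimes>\<^sub>M \<nu>)"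
    unfolding h_def by measurable
  have q: "distributed M lborel U (\<lambda>x. ennreal (q x))"
    using distributed_interpolation[OF \<alpha>] unfolding q_def U_def .
  have q0: "q x \<ge> 0" for x
    unfolding q_def using gauss_mean_pos \<alpha> by (simp add: less_imp_le)
  have hY: "h (U \<omega>, X1 \<omega>) = indicator B (U \<omega>) * (Y \<omega> \<bullet> i)" for \<omega>
    using \<alpha> by (simp add: h_def U_def Y_def algebra_simps)
  have intY: "integrable M (\<lambda>\<omega>. indicator B (U \<omega>) * (Y \<omega> \<bullet> i))"
    by (rule Bochner_Integration.integrable_bound[OF integrable_inner_Y[OF i]])
      (auto split: split_indicator)
  have J: "distributed M (lborel \<Otimes>\<^sub>M \<nu>) (\<lambda>\<omega>. (U \<omega>, X1 \<omega>)) (\<lambda>w. ennreal (noise_kernel \<alpha> \<beta> w))"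
    using distributed_joint[OF \<alpha>, of \<beta>] unfolding U_def .
  \<comment> \<open>Integrability for Fubini is inherited from the rate on the probability space, so
    no estimate of the kernel is involved.\<close>
  have int: "integrable (lborel \<Otimes>\<^sub>M \<nu>) (\<lambda>w. noise_kernel \<alpha> \<beta> w * h w)"
    using distributed_integrable[OF J, of h] intY by (simp add: noise_kernel_nonneg \<alpha> hY)
  have inner: "(LINT y|\<nu>. noise_kernel \<alpha> \<beta> (x, y) * h (x, y)) = q x * (indicator B x * (V x \<bullet> i))" for x
    using integral_noise_kernel_rate[OF \<alpha> i, of \<beta> x \<alpha>' \<beta>']
    unfolding h_def q_def V_def by (simp split: split_indicator)
  have "integrable lborel (\<lambda>x. q x * (indicator B x * (V x \<bullet> i)))"
    using Q.integrable_fst'[OF int] by (simp add: inner)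
  then show "integrable M (\<lambda>\<omega>. indicator B (U \<omega>) * (V (U \<omega>) \<bullet> i))"
    using distributed_integrable[OF q, of "\<lambda>x. indicator B x * (V x \<bullet> i)"] by (simp add: q0)
  have "(LINT \<omega>|M. indicator B (U \<omega>) * (Y \<omega> \<bullet> i)) =
      (LINT w|(lborel \<Otimes>\<^sub>M \<nu>). noise_kernel \<alpha> \<beta> w * h w)"
    using distributed_integral[OF J, of h] by (simp add: noise_kernel_nonneg \<alpha> hY)
  also have "\<dots> = (LINT x|lborel. q x * (indicator B x * (V x \<bullet> i)))"
    using Q.integral_fst'[OF int] by (simp add: inner)
  also have "\<dots> = (LINT \<omega>|M. indicator B (U \<omega>) * (V (U \<omega>) \<bullet> i))"
    using distributed_integral[OF q, of "\<lambda>x. indicator B x * (V x \<bullet> i)"] by (simp add: q0)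
  finally show "(LINT \<omega>|M. indicator B (U \<omega>) * (Y \<omega> \<bullet> i)) = \<dots>" .
qed

lemma is_cond_mean_cond_velocity: "is_cond_mean M U Y V"
  unfolding is_cond_mean_def
proof (intro conjI ballI)
  let ?F = "vimage_algebra (space M) U borel"
  fix i :: 'a assume i: "i \<in> Basis"
  interpret F: finite_measure_subalgebra M ?F
    by unfold_locales (auto simp: subalgebra_def sets_vimage_algebra2)
  show "AE \<omega> in M. real_cond_exp M ?F (\<lambda>\<omega>. Y \<omega> \<bullet> i) \<omega> = V (U \<omega>) \<bullet> i"
  proof (rule F.real_cond_exp_charact)
    fix A assume "A \<in> sets ?F"
    \<comment> \<open>Every event of the sigma-algebra generated by \<open>U\<close> is a preimage,
      so the identity for Borel indicators is enough.\<close>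
    then obtain B where B: "B \<in> sets borel" "A = U -` B \<inter> space M"
      by (auto simp: sets_vimage_algebra2)
    have "indicator A \<omega> = (indicator B (U \<omega>) :: real)" if "\<omega> \<in> space M" for \<omega>
      using that B(2) by (auto split: split_indicator)
    then show "(LINT \<omega>:A|M. Y \<omega> \<bullet> i) = (LINT \<omega>:A|M. V (U \<omega>) \<bullet> i)"
      using expectation_rate_indicator(2)[OF i B(1)]
      unfolding set_lebesgue_integral_def by (simp cong: Bochner_Integration.integral_cong)
  next
    show "integrable M (\<lambda>\<omega>. V (U \<omega>) \<bullet> i)"
      using expectation_rate_indicator(1)[OF i, of UNIV] by simp
    have "U \<in> ?F \<rightarrow>\<^sub>M borel" by (rule measurable_vimage_algebra1) auto
    then show "(\<lambda>\<omega>. V (U \<omega>) \<bullet> i) \<in> borel_measurable ?F" by measurable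
  qed (rule integrable_inner_Y[OF i])
qed measurable

text \<open>Two versions agree almost everywhere under the law of \<open>U\<close>. That law has an
  everywhere positive density, so they agree Lebesgue-almost everywhere, and continuity removes the
  exceptional set. This gives the definite description in \<open>cond_mean\<close> its
  value.\<close>

lemma continuous_cond_mean_unique:
  assumes g: "continuous_on UNIV g" "is_cond_mean M U Y g"
  shows "g = V"
proof (rule AE_lborel_eq_imp_eq[OF g(1) continuous_on_V])
  have [measurable]: "g \<in> borel_measurable borel" by (rule borel_measurable_continuous_onI[OF g(1)])
  have "AE \<omega> in M. \<forall>i\<in>Basis. g (U \<omega>) \<bullet> i = V (U \<omega>) \<bullet> i"
  proof (rule AE_finite_allI)
    fix i :: 'a assume "i \<in> Basis"
    then have "AE \<omega> in M. real_cond_exp M (vimage_algebra (space M) U borel) (\<lambda>\<omega>. Y \<omega> \<bullet> i) \<omega> = g (U \<omega>) \<bullet> i"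
      "AE \<omega> in M. real_cond_exp M (vimage_algebra (space M) U borel) (\<lambda>\<omega>. Y \<omega> \<bullet> i) \<omega> = V (U \<omega>) \<bullet> i"
      using g(2) is_cond_mean_cond_velocity unfolding is_cond_mean_def by blast+
    then show "AE \<omega> in M. g (U \<omega>) \<bullet> i = V (U \<omega>) \<bullet> i"
      by eventually_elim simp
  qed simp
  then have "AE \<omega> in M. g (U \<omega>) = V (U \<omega>)"
    by eventually_elim (blast intro: euclidean_eqI)
  then have "AE x in distr M lborel U. g x = V x" by (subst AE_distr_iff) auto
  moreover define q where "q x = ennreal (kernel_mean \<nu> gauss_density (\<lambda>_. 1) (\<alpha>, \<beta>, x) / \<alpha> ^ DIM('a))" for x
  have "distributed M lborel U q"
    using distributed_interpolation[OF \<alpha>, of \<beta>] unfolding U_def q_def .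
  then have "distr M lborel U = density lborel q" "q \<in> borel_measurable lborel"
    unfolding distributed_def by auto
  ultimately have "AE x in lborel. 0 < q x \<longrightarrow> g x = V x" by (simp only: AE_density)
  then show "AE x in lborel. g x = V x" by (simp add: q_def gauss_mean_pos \<alpha>)
qed

lemma cond_mean_eq_cond_velocity: "cond_mean M U Y = V"
  unfolding cond_mean_def
  by (rule the_equality)
    (auto simp: continuous_on_V is_cond_mean_cond_velocity dest: continuous_cond_mean_unique)

text \<open>Contraction in L1, coordinate by coordinate: the absolute value of a coordinate of
  \<open>V\<close> is the coordinate times its sign, and the sign is a difference of two indicators
  of the position, to which the defining identity applies.\<close>

lemma expectation_abs_cond_mean_le:
  assumes i: "i \<in> Basis"
  shows "(LINT \<omega>|M. \<bar>V (U \<omega>) \<bullet> i\<bar>) \<le> (LINT \<omega>|M. \<bar>Y \<omega> \<bullet> i\<bar>)"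
proof -
  define B where "B = {x. V x \<bullet> i \<ge> 0}"
  have B: "B \<in> sets borel" "- B \<in> sets borel" unfolding B_def by measurable
  have intY: "integrable M (\<lambda>\<omega>. indicator C (U \<omega>) * (Y \<omega> \<bullet> i))" if [measurable]: "C \<in> sets borel" for C
    by (rule Bochner_Integration.integrable_bound[OF integrable_inner_Y[OF i]])
      (auto split: split_indicator)
  have "(LINT \<omega>|M. \<bar>V (U \<omega>) \<bullet> i\<bar>) =
      (LINT \<omega>|M. indicator B (U \<omega>) * (V (U \<omega>) \<bullet> i) - indicator (- B) (U \<omega>) * (V (U \<omega>) \<bullet> i))"
    by (intro Bochner_Integration.integral_cong) (auto simp: B_def split: split_indicator)
  also have "\<dots> = (LINT \<omega>|M. indicator B (U \<omega>) * (Y \<omega> \<bullet> i)) - (LINT \<omega>|M. indicator (- B) (U \<omega>) * (Y \<omega> \<bullet> i))"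
    using B by (simp add: expectation_rate_indicator i)
  also have "\<dots> = (LINT \<omega>|M. indicator B (U \<omega>) * (Y \<omega> \<bullet> i) - indicator (- B) (U \<omega>) * (Y \<omega> \<bullet> i))"
    using B by (simp add: intY)
  also have "\<dots> \<le> (LINT \<omega>|M. \<bar>Y \<omega> \<bullet> i\<bar>)"
    using B integrable_inner_Y[OF i]
    by (intro integral_mono) (auto intro!: intY Bochner_Integration.integrable_diff integrable_abs split: split_indicator)
  finally show ?thesis .
qed

text \<open>A bounded function of the position can be taken out of the conditional expectation.
  Applied with \<open>f\<close> a spatial partial derivative of a test function, this exchanges the
  rate for the velocity.\<close>

lemma expectation_mult_cond_mean:
  assumes i: "i \<in> Basis" and f [measurable]: "f \<in> borel_measurable borel" and C: "\<And>x. \<bar>f x\<bar> \<le> C"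
  shows "integrable M (\<lambda>\<omega>. f (U \<omega>) * (Y \<omega> \<bullet> i))"
    and "integrable M (\<lambda>\<omega>. f (U \<omega>) * (V (U \<omega>) \<bullet> i))"
    and "(LINT \<omega>|M. f (U \<omega>) * (Y \<omega> \<bullet> i)) = (LINT \<omega>|M. f (U \<omega>) * (V (U \<omega>) \<bullet> i))"
proof -
  let ?F = "vimage_algebra (space M) U borel"
  interpret F: finite_measure_subalgebra M ?F
    by unfold_locales (auto simp: subalgebra_def sets_vimage_algebra2)
  have fU [measurable]: "(\<lambda>\<omega>. f (U \<omega>)) \<in> borel_measurable ?F"
  proof -
    have "U \<in> ?F \<rightarrow>\<^sub>M borel" by (rule measurable_vimage_algebra1) auto
    then show ?thesis by measurable
  qed
  show int: "integrable M (\<lambda>\<omega>. f (U \<omega>) * (Y \<omega> \<bullet> i))"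
  proof (rule Bochner_Integration.integrable_bound)
    show "integrable M (\<lambda>\<omega>. C * (Y \<omega> \<bullet> i))" using integrable_inner_Y[OF i] by simp
    show "AE \<omega> in M. norm (f (U \<omega>) * (Y \<omega> \<bullet> i)) \<le> norm (C * (Y \<omega> \<bullet> i))"
      using C by (intro AE_I2) (auto simp: abs_mult intro!: mult_right_mono order_trans[OF C])
  qed measurable
  have AE: "AE \<omega> in M. f (U \<omega>) * real_cond_exp M ?F (\<lambda>\<omega>. Y \<omega> \<bullet> i) \<omega> = f (U \<omega>) * (V (U \<omega>) \<bullet> i)"
    using is_cond_mean_cond_velocity i unfolding is_cond_mean_def by auto
  have I: "integrable M (\<lambda>\<omega>. f (U \<omega>) * real_cond_exp M ?F (\<lambda>\<omega>. Y \<omega> \<bullet> i) \<omega>)"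
    "(LINT \<omega>|M. f (U \<omega>) * real_cond_exp M ?F (\<lambda>\<omega>. Y \<omega> \<bullet> i) \<omega>) = (LINT \<omega>|M. f (U \<omega>) * (Y \<omega> \<bullet> i))"
    by (intro F.real_cond_exp_intg int fU; measurable)+
  show "integrable M (\<lambda>\<omega>. f (U \<omega>) * (V (U \<omega>) \<bullet> i))"
    by (rule integrable_cong_AE_imp[OF I(1)]) (use AE in \<open>auto elim: AE_mp\<close>)
  have "(LINT \<omega>|M. f (U \<omega>) * real_cond_exp M ?F (\<lambda>\<omega>. Y \<omega> \<bullet> i) \<omega>) = (LINT \<omega>|M. f (U \<omega>) * (V (U \<omega>) \<bullet> i))"
    by (rule integral_cong_AE) (use AE in auto)
  then show "(LINT \<omega>|M. f (U \<omega>) * (Y \<omega> \<bullet> i)) = (LINT \<omega>|M. f (U \<omega>) * (V (U \<omega>) \<bullet> i))"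
    using I(2) by simp
qed

end

end

section \<open>Schedules and test functions\<close>

lemma C_k_on_Suc_imp_continuous_on: "C_k_on (Suc k) f S \<Longrightarrow> continuous_on S f"
  by (auto simp: continuous_on_eq_continuous_within intro: has_derivative_continuous)

text \<open>\<open>time_deriv\<close> differentiates within the closed interval, the smoothness
  hypothesis within the half-open one. The two agree near any time before 1, and in the interior
  both are the two-sided derivative.\<close>

lemma C_2_time_deriv:
  fixes f :: "real \<Rightarrow> real"
  assumes "C_k_on 2 f {0..<1}"
  shows "continuous_on {0..<1} (time_deriv f)"
    and "t \<in> {0<..<1} \<Longrightarrow> (f has_vector_derivative time_deriv f t) (at t)"
proof -
  obtain f' where f': "\<And>t. t \<in> {0..<1} \<Longrightarrow> (f has_derivative f' t) (at t within {0..<1})"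
    and C: "\<And>h. C_k_on (Suc 0) (\<lambda>t. f' t h) {0..<1}"
    using assms unfolding numeral_2_eq_2 C_k_on.simps(2)[of "Suc 0"] by blast
  have vd: "(f has_vector_derivative f' t 1) (at t within {0..<1})" if "t \<in> {0..<1}" for t
  proof -
    have "linear (f' t)" using f'[OF that] by (rule has_derivative_linear)
    then have "f' t = (\<lambda>h. h *\<^sub>R f' t 1)"
      by (intro ext) (metis linear_scale mult.right_neutral real_scaleR_def)
    then show ?thesis using f'[OF that] unfolding has_vector_derivative_def by metis
  qed
  have eq: "time_deriv f t = f' t 1" if t: "t \<in> {0..<1}" for t
  proof -
    have "at t within {0..<1} = at t within {0..1}"
      by (rule at_within_nhd[of t "{..<1}"]) (use t in auto)
    then show ?thesis
      using vd[OF t] t unfolding time_deriv_def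
      by (intro vector_derivative_within_closed_interval) auto
  qed
  have "continuous_on {0..<1} (\<lambda>t. f' t 1)" using C by (rule C_k_on_Suc_imp_continuous_on)
  then show "continuous_on {0..<1} (time_deriv f)" by (rule continuous_on_eq) (simp add: eq)
  show "(f has_vector_derivative time_deriv f t) (at t)" if t: "t \<in> {0<..<1}"
  proof -
    have "at t within {0..<1} = at t" by (rule at_within_open_subset[of _ "{0<..<1}"]) (use t in auto)
    then show ?thesis using vd[of t] t by (simp add: eq)
  qed
qed

text \<open>The integral of a nonnegative derivative over inner intervals is an increment of
  \<open>F\<close>, which stays bounded by continuity at the ends. The derivative itself may blow up
  there.\<close>

lemma set_integrable_nonneg_deriv:
  fixes F f :: "real \<Rightarrow> real"
  assumes F: "continuous_on {0..1} F" and f: "continuous_on {0<..<1} f"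
    and F': "\<And>t. t \<in> {0<..<1} \<Longrightarrow> (F has_vector_derivative f t) (at t)"
    and nn: "\<And>t. t \<in> {0<..<1} \<Longrightarrow> f t \<ge> 0"
  shows "set_integrable lborel {0<..<1} f"
proof -
  have "set_integrable lborel (einterval (ereal 0) (ereal 1)) f"
  proof (rule interval_integral_FTC_nonneg)
    show "((F \<circ> real_of_ereal) \<longlongrightarrow> F 0) (at_right (ereal 0))"
      "((F \<circ> real_of_ereal) \<longlongrightarrow> F 1) (at_left (ereal 1))"
      using F by (auto simp: ereal_tendsto_simps1 dest: continuous_on_Icc_at_rightD continuous_on_Icc_at_leftD)
    show "isCont f x" if "ereal 0 < ereal x" "ereal x < ereal 1" for x
      using f that by (simp add: continuous_on_eq_continuous_at)
  qed (use F' nn in \<open>auto simp: has_real_derivative_iff_has_vector_derivative\<close>)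
  then show ?thesis by simp
qed

section \<open>Bounds for test functions with compact support\<close>

lemma bounded_if_compact_support:
  fixes g :: "'a::topological_space \<Rightarrow> real"
  assumes g: "continuous_on UNIV g" and K: "compact K" and zero: "\<And>z. z \<notin> K \<Longrightarrow> g z = 0"
  shows "\<exists>C. \<forall>z. \<bar>g z\<bar> \<le> C"
proof -
  have "compact (g ` K)" using g K by (meson compact_continuous_image continuous_on_subset subset_UNIV)
  then obtain C where C: "\<And>z. z \<in> K \<Longrightarrow> \<bar>g z\<bar> \<le> C"
    using compact_imp_bounded bounded_real by (metis imageI)
  have "\<bar>g z\<bar> \<le> \<bar>C\<bar>" for z using C[of z] zero[of z] by (cases "z \<in> K") auto
  then show ?thesis by blast
qed

text \<open>On the open complement of the closed support the function is zero, hence so is its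
  differential. Continuity in each direction then gives a bound that depends on the direction
  \<open>h\<close> but not on the point, the form used after expansion in a basis.\<close>

lemma test_function_derivative:
  fixes \<phi> :: "'a::real_normed_vector \<Rightarrow> real"
  assumes "test_function \<phi>"
  shows "\<exists>\<phi>' C. (\<forall>z. (\<phi> has_derivative \<phi>' z) (at z)) \<and> (\<forall>h. continuous_on UNIV (\<lambda>z. \<phi>' z h)) \<and>
    (\<forall>z h. \<bar>\<phi>' z h\<bar> \<le> C h) \<and> (\<exists>C0. \<forall>z. \<bar>\<phi> z\<bar> \<le> C0)"
proof -
  let ?K = "closure {z. \<phi> z \<noteq> 0}"
  have K: "compact ?K" and sm: "C_k_on (Suc 0) \<phi> UNIV"
    using assms by (simp_all only: test_function_def)
  obtain \<phi>' where d: "\<And>z. (\<phi> has_derivative \<phi>' z) (at z)"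
    and c: "\<And>h. continuous_on UNIV (\<lambda>z. \<phi>' z h)"
    using sm unfolding C_k_on.simps by blast
  have out: "\<phi> z = 0" if "z \<notin> ?K" for z
    using that closure_subset[of "{z. \<phi> z \<noteq> 0}"] by auto
  have "\<phi>' z h = 0" if z: "z \<notin> ?K" for z h
  proof -
    have "((\<lambda>_. 0) has_derivative \<phi>' z) (at z)"
    proof (rule has_derivative_transform_within_open[OF d])
      show "open (- ?K)" "z \<in> - ?K" using z by auto
      show "\<phi> x = 0" if "x \<in> - ?K" for x using that by (intro out) simp
    qed
    then have "\<phi>' z = (\<lambda>_. 0)" by (rule has_derivative_unique[OF _ has_derivative_const])
    then show ?thesis by simp
  qed
  then have "\<forall>h. \<exists>C. \<forall>z. \<bar>\<phi>' z h\<bar> \<le> C" by (intro allI bounded_if_compact_support[OF c K])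
  from choice[OF this] obtain C where C: "\<bar>\<phi>' z h\<bar> \<le> C h" for z h by blast
  have "\<exists>C0. \<forall>z. \<bar>\<phi> z\<bar> \<le> C0"
    using C_k_on_Suc_imp_continuous_on[OF sm] K out by (rule bounded_if_compact_support)
  then show ?thesis using d c C by (intro exI[of _ \<phi>'] exI[of _ C]) simp
qed

text \<open>\<open>enn2real\<close> sends infinity to 0. For a probability measure the derivative is
  finite almost everywhere, so passing to real values changes it on a null set only.\<close>

lemma density_enn2real_RN_deriv:
  assumes N: "prob_space N" "sets N = sets lborel" and ac: "absolutely_continuous lborel N"
  shows "AE x in lborel. ennreal (enn2real (RN_deriv lborel N x)) = RN_deriv lborel N x"
    and "density lborel (\<lambda>x. ennreal (enn2real (RN_deriv lborel N x))) = N"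
proof -
  have "AE x in lborel. RN_deriv lborel N x \<noteq> \<infinity>"
    using prob_space_imp_sigma_finite[OF N(1)] ac N(2)
    by (rule sigma_finite_measure.RN_deriv_finite[OF sigma_finite_lborel])
  then show AE: "AE x in lborel. ennreal (enn2real (RN_deriv lborel N x)) = RN_deriv lborel N x"
    by eventually_elim (simp add: less_top)
  have "density lborel (\<lambda>x. ennreal (enn2real (RN_deriv lborel N x))) = density lborel (RN_deriv lborel N)"
    by (rule density_cong[OF _ _ AE]) auto
  also have "\<dots> = N" by (rule sigma_finite_measure.density_RN_deriv[OF sigma_finite_lborel ac N(2)])
  finally show "density lborel (\<lambda>x. ennreal (enn2real (RN_deriv lborel N x))) = N" .
qed

section \<open>Velocity and marginal laws along a schedule\<close>

locale scheduled_interpolation = gaussian_interpolation M Z X1 \<nu>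
  for M :: "'w measure" and Z X1 :: "'w \<Rightarrow> 'a::euclidean_space" and \<nu> :: "'a measure" +
  fixes a b :: "real \<Rightarrow> real"
  assumes sched: "interpolation_schedule a b" and ac: "absolutely_continuous lborel \<nu>"
begin

abbreviation X where "X \<equiv> interpolant a b Z X1"
abbreviation R where "R \<equiv> interpolant_rate a b Z X1"
abbreviation p where "p \<equiv> marginal_density M a b Z X1"
abbreviation v where "v \<equiv> velocity M a b Z X1"

lemma X_eq: "X t = (\<lambda>\<omega>. a t *\<^sub>R Z \<omega> + b t *\<^sub>R X1 \<omega>)"
  and R_eq: "R t = (\<lambda>\<omega>. time_deriv a t *\<^sub>R Z \<omega> + time_deriv b t *\<^sub>R X1 \<omega>)"
  by (auto simp: interpolant_def interpolant_rate_def)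

lemma borel_measurable_XR [measurable]: "X t \<in> borel_measurable M" "R t \<in> borel_measurable M"
  unfolding X_eq R_eq by auto

lemma a_pos: "t \<in> {0..<1} \<Longrightarrow> a t > 0"
  using sched unfolding interpolation_schedule_def by (cases "t = 0") auto

lemma a_1 [simp]: "a 1 = 0" and b_1 [simp]: "b 1 = 1"
  using sched unfolding interpolation_schedule_def by auto

lemma continuous_on_time_deriv:
  "continuous_on {0..<1} (time_deriv a)" "continuous_on {0..<1} (time_deriv b)"
  using sched C_2_time_deriv(1) unfolding interpolation_schedule_def by blast+

lemma has_time_deriv:
  assumes "t \<in> {0<..<1}"
  shows "(a has_vector_derivative time_deriv a t) (at t)" "(b has_vector_derivative time_deriv b t) (at t)"
  using sched C_2_time_deriv(2) assms unfolding interpolation_schedule_def by blast+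

lemma continuous_on_schedule: "continuous_on {0..1} a" "continuous_on {0..1} b"
proof -
  have C: "C_k_on (Suc 0) (\<lambda>t. (a t)\<^sup>2) {0..1}" "C_k_on (Suc 0) b {0..1}"
    using sched unfolding interpolation_schedule_def One_nat_def by blast+
  show "continuous_on {0..1} b" by (rule C_k_on_Suc_imp_continuous_on[OF C(2)])
  \<comment> \<open>At time 1 smoothness is given for the square of \<open>a\<close>; continuity of
    \<open>a\<close> itself is regained through the square root, which requires
    nonnegativity.\<close>
  have "a t \<ge> 0" if "t \<in> {0..1}" for t using a_pos[of t] that by (cases "t = 1") auto
  then have abs_a: "sqrt ((a t)\<^sup>2) = a t" if "t \<in> {0..1}" for t using that by simp
  have "continuous_on {0..1} (\<lambda>t. sqrt ((a t)\<^sup>2))"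
    by (intro continuous_intros C_k_on_Suc_imp_continuous_on[OF C(1)])
  then show "continuous_on {0..1} a" by (rule continuous_on_eq) (rule abs_a)
qed

lemma set_integrable_time_deriv:
  "set_integrable lborel {0<..<1} (time_deriv a)" "set_integrable lborel {0<..<1} (time_deriv b)"
proof -
  have sub: "{0<..<1} \<subseteq> {0..<1::real}" by auto
  note cont = continuous_on_time_deriv[THEN continuous_on_subset[OF _ sub]]
  have sgn: "time_deriv a t \<le> 0" "time_deriv b t \<ge> 0" if "t \<in> {0<..<1}" for t
    using sched that unfolding interpolation_schedule_def by auto
  \<comment> \<open>\<open>a\<close> decreases, so the result for nonnegative derivatives is applied
    to its negative.\<close>
  have "set_integrable lborel {0<..<1} (\<lambda>t. - time_deriv a t)"
    by (rule set_integrable_nonneg_deriv[of "\<lambda>t. - a t"])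
      (use sgn cont in \<open>auto intro!: continuous_intros continuous_on_schedule derivative_intros has_time_deriv\<close>)
  then show "set_integrable lborel {0<..<1} (time_deriv a)"
    by (simp add: set_integrable_def)
  show "set_integrable lborel {0<..<1} (time_deriv b)"
    by (rule set_integrable_nonneg_deriv[of b])
      (use sgn cont in \<open>auto intro!: continuous_on_schedule has_time_deriv\<close>)
qed

lemma velocity_eq:
  assumes "t \<in> {0<..<1}"
  shows "v t x = cond_velocity \<nu> (time_deriv a t) (time_deriv b t) (a t, b t, x)"
  using assms unfolding velocity_def Let_def X_eq R_eq
  by (simp add: cond_mean_eq_cond_velocity a_pos)

lemma continuous_on_velocity: "t \<in> {0<..<1} \<Longrightarrow> continuous_on UNIV (v t)"
  using continuous_on_V[where \<alpha> = "a t" and \<beta> = "b t" and \<alpha>' = "time_deriv a t" and \<beta>' = "time_deriv b t"]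
  by (simp add: velocity_eq[THEN ext] a_pos)

lemma is_cond_mean_velocity: "t \<in> {0<..<1} \<Longrightarrow> is_cond_mean M (X t) (R t) (v t)"
  using is_cond_mean_cond_velocity[where \<alpha> = "a t" and \<beta> = "b t" and \<alpha>' = "time_deriv a t" and \<beta>' = "time_deriv b t"]
  by (simp add: velocity_eq[THEN ext] a_pos X_eq R_eq)

text \<open>Since \<open>a 0\<close> is positive, Bayes' formula still makes sense at time 0 and is
  continuous there from the right. The limit exists, so \<open>Lim\<close> in the definition of
  \<open>v 0\<close> takes its proper value.\<close>

lemma velocity_tendsto_0: "((\<lambda>t. v t x) \<longlongrightarrow> v 0 x) (at_right 0)"
proof -
  let ?l = "cond_velocity \<nu> (time_deriv a 0) (time_deriv b 0) (a 0, b 0, x)"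
  let ?u = "\<lambda>t. cond_mean M (X t) (R t) x"
  have sub: "{0..<1} \<subseteq> {0..1::real}" by auto
  have "continuous_on {0..<1} (\<lambda>t. cond_velocity \<nu> (time_deriv a t) (time_deriv b t) (a t, b t, x))"
    by (intro continuous_on_cond_velocity continuous_on_time_deriv continuous_on_const
        continuous_on_schedule[THEN continuous_on_subset[OF _ sub]] a_pos)
  then have "((\<lambda>t. cond_velocity \<nu> (time_deriv a t) (time_deriv b t) (a t, b t, x)) \<longlongrightarrow> ?l) (at 0 within {0..<1})"
    by (auto simp: continuous_on_def)
  moreover have "at 0 within {0..<1} = at_right (0::real)"
    by (rule at_within_nhd[of _ "{..<1}"]) auto
  ultimately have lim: "((\<lambda>t. cond_velocity \<nu> (time_deriv a t) (time_deriv b t) (a t, b t, x)) \<longlongrightarrow> ?l) (at_right 0)"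
    by simp
  have ev: "\<forall>\<^sub>F t in at_right 0. t \<in> {0<..<1::real}" by (rule eventually_at_right_real) simp
  have "(?u \<longlongrightarrow> ?l) (at_right 0)"
    by (rule Lim_transform_eventually[OF lim], use ev in eventually_elim)
      (simp add: velocity_eq[symmetric] velocity_def Let_def)
  then have "Lim (at_right 0) ?u = ?l" by (intro tendsto_Lim) auto
  then have "v 0 x = ?l" by (simp add: velocity_def Let_def)
  moreover have "((\<lambda>t. v t x) \<longlongrightarrow> ?l) (at_right 0)"
    by (rule Lim_transform_eventually[OF lim], use ev in eventually_elim) (simp add: velocity_eq)
  ultimately show ?thesis by simp
qed

lemma borel_measurable_velocity:
  "(\<lambda>(t, x). v t x) \<in> borel_measurable (restrict_space borel ({0<..<1} \<times> UNIV))"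
proof (rule borel_measurable_continuous_on_restrict)
  have "continuous_on ({0<..<1} \<times> UNIV)
      (\<lambda>z. cond_velocity \<nu> (time_deriv a (fst z)) (time_deriv b (fst z)) (a (fst z), b (fst z), snd z))"
    by (intro continuous_on_cond_velocity continuous_on_time_deriv[THEN continuous_on_compose2]
        continuous_on_schedule[THEN continuous_on_compose2] continuous_on_fst continuous_on_snd
        continuous_on_id a_pos) auto
  then show "continuous_on ({0<..<1} \<times> UNIV) (\<lambda>(t, x). v t x)"
    by (rule continuous_on_eq) (auto simp: velocity_eq)
qed

lemma X_1 [simp]: "X 1 = X1" by (simp add: X_eq)

text \<open>Before time 1 the Gaussian noise provides a density. At time 1 the noise has vanished,
  and absolute continuity of \<nu> takes over.\<close>

lemma marginal_absolutely_continuous: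
  assumes t: "t \<in> {0..1}"
  shows "absolutely_continuous lborel (distr M borel (X t))"
proof (cases "t = 1")
  case True
  then show ?thesis using ac by (simp add: distr_X1)
next
  case False
  then have "a t > 0" using t by (intro a_pos) auto
  note D = distributed_interpolation[OF this, of "b t", folded X_eq, unfolded distributed_def]
  have "distr M borel (X t) = distr M lborel (X t)" by (rule distr_cong) auto
  then show ?thesis using D by (simp add: absolutely_continuousI_density)
qed

lemma
  assumes t: "t \<in> {0..1}"
  shows distributed_marginal: "distributed M lborel (X t) (\<lambda>x. ennreal (p t x))"
    and marginal_density_eq: "AE x in lborel. ennreal (p t x) = RN_deriv lborel (distr M borel (X t)) x"
proof -
  note N = density_enn2real_RN_deriv[OF prob_space_distr[OF borel_measurable_XR(1)] _
      marginal_absolutely_continuous[OF t], folded marginal_density_def]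
  show "AE x in lborel. ennreal (p t x) = RN_deriv lborel (distr M borel (X t)) x"
    using N(1) by simp
  have "distr M lborel (X t) = distr M borel (X t)" by (rule distr_cong) auto
  moreover have "p t \<in> borel_measurable borel" unfolding marginal_density_def[abs_def] by measurable
  ultimately show "distributed M lborel (X t) (\<lambda>x. ennreal (p t x))"
    using N(2) unfolding distributed_def by simp
qed

lemma marginal_density_nonneg: "p t x \<ge> 0"
  unfolding marginal_density_def by simp

lemma borel_measurable_velocity_at [measurable]: "t \<in> {0<..<1} \<Longrightarrow> v t \<in> borel_measurable borel"
  by (intro borel_measurable_continuous_onI continuous_on_velocity)

text \<open>The integral over \<open>K\<close> is bounded by the one over the whole space, which is
  the expected norm of the velocity at \<open>X t\<close>. Contraction of conditional means reduces
  this to first moments of the rate.\<close>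

lemma velocity_locally_integrable:
  "(\<integral>\<^sup>+t\<in>{0<..<1}. (\<integral>\<^sup>+x\<in>K. ennreal (norm (v t x) * p t x) \<partial>lborel) \<partial>lborel) < \<infinity>"
proof -
  \<comment> \<open>\<open>g\<close> bounds the expected sum of absolute coordinates of the rate. It
    is integrable in time because the derivatives of \<open>a\<close> and \<open>b\<close>
    are.\<close>
  define g where "g t = \<bar>time_deriv a t\<bar> * (\<Sum>i\<in>Basis. LINT \<omega>|M. \<bar>Z \<omega> \<bullet> i\<bar>) +
    \<bar>time_deriv b t\<bar> * (\<Sum>i\<in>Basis. LINT \<omega>|M. \<bar>X1 \<omega> \<bullet> i\<bar>)" for t
  have bound: "(\<integral>\<^sup>+x\<in>K. ennreal (norm (v t x) * p t x) \<partial>lborel) \<le> ennreal (g t)" if t: "t \<in> {0<..<1}" for t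
  proof -
    note [measurable] = borel_measurable_velocity_at[OF t]
    have at: "a t > 0" using t by (intro a_pos) auto
    have D: "distributed M lborel (X t) (\<lambda>x. ennreal (p t x))" using t by (intro distributed_marginal) auto
    have int: "integrable M (\<lambda>\<omega>. v t (X t \<omega>) \<bullet> i)" if "i \<in> Basis" for i
      using expectation_rate_indicator(1)[OF at that, where B = UNIV and \<beta> = "b t" and \<alpha>' = "time_deriv a t" and \<beta>' = "time_deriv b t"]
      by (simp add: velocity_eq[OF t] X_eq)
    have "(\<integral>\<^sup>+x\<in>K. ennreal (norm (v t x) * p t x) \<partial>lborel) \<le> (\<integral>\<^sup>+x. ennreal (p t x) * ennreal (norm (v t x)) \<partial>lborel)"
      by (intro nn_integral_mono) (auto simp: ennreal_mult' mult.commute marginal_density_nonneg split: split_indicator)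
    also have "\<dots> = (\<integral>\<^sup>+\<omega>. ennreal (norm (v t (X t \<omega>))) \<partial>M)"
      using distributed_nn_integral[OF D, of "\<lambda>x. ennreal (norm (v t x))"] by simp
    also have "\<dots> \<le> (\<integral>\<^sup>+\<omega>. ennreal (\<Sum>i\<in>Basis. \<bar>v t (X t \<omega>) \<bullet> i\<bar>) \<partial>M)"
      by (intro nn_integral_mono ennreal_leI norm_le_l1)
    also have "\<dots> = ennreal (\<Sum>i\<in>Basis. LINT \<omega>|M. \<bar>v t (X t \<omega>) \<bullet> i\<bar>)"
      using int by (subst nn_integral_eq_integral) (auto intro!: sum_nonneg)
    also have "\<dots> \<le> ennreal (g t)"
    proof (rule ennreal_leI)
      have "(LINT \<omega>|M. \<bar>v t (X t \<omega>) \<bullet> i\<bar>) \<le>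
          \<bar>time_deriv a t\<bar> * (LINT \<omega>|M. \<bar>Z \<omega> \<bullet> i\<bar>) + \<bar>time_deriv b t\<bar> * (LINT \<omega>|M. \<bar>X1 \<omega> \<bullet> i\<bar>)"
        if i: "i \<in> Basis" for i
      proof -
        have "(LINT \<omega>|M. \<bar>v t (X t \<omega>) \<bullet> i\<bar>) \<le> (LINT \<omega>|M. \<bar>R t \<omega> \<bullet> i\<bar>)"
          using expectation_abs_cond_mean_le[OF at i, where \<beta> = "b t" and \<alpha>' = "time_deriv a t" and \<beta>' = "time_deriv b t"]
          by (simp add: velocity_eq[OF t] X_eq R_eq)
        also have "\<dots> \<le> (LINT \<omega>|M. \<bar>time_deriv a t\<bar> * \<bar>Z \<omega> \<bullet> i\<bar> + \<bar>time_deriv b t\<bar> * \<bar>X1 \<omega> \<bullet> i\<bar>)"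
          using integrable_inner_Z[OF i] integrable_X1
          by (intro integral_mono) (auto simp: R_eq inner_add_left abs_mult[symmetric] abs_triangle_ineq)
        also have "\<dots> = \<bar>time_deriv a t\<bar> * (LINT \<omega>|M. \<bar>Z \<omega> \<bullet> i\<bar>) + \<bar>time_deriv b t\<bar> * (LINT \<omega>|M. \<bar>X1 \<omega> \<bullet> i\<bar>)"
          using integrable_inner_Z[OF i] integrable_X1 by simp
        finally show ?thesis .
      qed
      then show "(\<Sum>i\<in>Basis. LINT \<omega>|M. \<bar>v t (X t \<omega>) \<bullet> i\<bar>) \<le> g t"
        unfolding g_def sum_distrib_left sum.distrib[symmetric] by (rule sum_mono)
    qed
    finally show ?thesis .
  qed
  have "set_integrable lborel {0<..<1} g"
    unfolding g_def using set_integrable_time_deriv by (auto intro!: set_integral_add set_integrable_abs)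
  then have fin: "(\<integral>\<^sup>+t. ennreal (norm (indicator {0<..<1} t *\<^sub>R g t)) \<partial>lborel) < \<infinity>"
    unfolding set_integrable_def integrable_iff_bounded by simp
  have "(\<integral>\<^sup>+t\<in>{0<..<1}. (\<integral>\<^sup>+x\<in>K. ennreal (norm (v t x) * p t x) \<partial>lborel) \<partial>lborel)
      \<le> (\<integral>\<^sup>+t. ennreal (norm (indicator {0<..<1} t *\<^sub>R g t)) \<partial>lborel)"
    using bound by (intro nn_integral_mono)
      (auto split: split_indicator intro: order_trans[OF bound ennreal_leI[OF abs_ge_self]])
  then show ?thesis using fin by (rule le_less_trans)
qed

end

section \<open>The weak continuity equation\<close>

locale tested_interpolation = scheduled_interpolation M Z X1 \<nu> a b
  for M :: "'w measure" and Z X1 :: "'w \<Rightarrow> 'a::euclidean_space" and \<nu> :: "'a measure" and a b +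
  fixes \<phi> :: "real \<times> 'a \<Rightarrow> real" and \<phi>' C
  assumes \<phi>': "\<And>z. (\<phi> has_derivative \<phi>' z) (at z)"
    and cont_\<phi>': "\<And>h. continuous_on UNIV (\<lambda>z. \<phi>' z h)"
    and C: "\<And>z h. \<bar>\<phi>' z h\<bar> \<le> C h"
    and bounded: "\<exists>C0. \<forall>z. \<bar>\<phi> z\<bar> \<le> C0"
begin

lemma continuous_on_\<phi>: "continuous_on UNIV \<phi>"
  by (rule continuous_at_imp_continuous_on) (use \<phi>' has_derivative_continuous in blast)

lemma borel_measurable_\<phi> [measurable]: "\<phi> \<in> borel_measurable borel"
  "(\<lambda>z. \<phi>' z h) \<in> borel_measurable borel"
  by (intro borel_measurable_continuous_onI continuous_on_\<phi> cont_\<phi>')+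

lemma C_nonneg: "C h \<ge> 0" using C[of undefined h] by linarith

text \<open>Linearity separates bounded coefficients, the partial derivatives, from the coordinates
  of the direction. Conditional means and moment bounds are available for exactly these
  coordinates.\<close>

lemma \<phi>'_expand:
  "\<phi>' z (s, w) = s * \<phi>' z (1, 0) + (\<Sum>i\<in>Basis. \<phi>' z (0, i) * (w \<bullet> i))"
proof -
  have lin: "linear (\<phi>' z)" using \<phi>' by (rule has_derivative_linear)
  have "(s, w) = s *\<^sub>R (1, 0) + (\<Sum>i\<in>Basis. (w \<bullet> i) *\<^sub>R (0, i))"
    by (simp add: prod_eq_iff fst_sum snd_sum euclidean_representation)
  then have "\<phi>' z (s, w) = \<phi>' z (s *\<^sub>R (1, 0) + (\<Sum>i\<in>Basis. (w \<bullet> i) *\<^sub>R (0, i)))" by simp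
  also have "\<dots> = s * \<phi>' z (1, 0) + (\<Sum>i\<in>Basis. \<phi>' z (0, i) * (w \<bullet> i))"
    by (simp only: linear_add[OF lin] linear_sum[OF lin] linear_scale[OF lin] real_scaleR_def mult.commute)
  finally show ?thesis .
qed

text \<open>The two partial derivatives in the weak formulation are restrictions of the total
  differential, by the chain rule along \<open>s \<mapsto> (s, x)\<close> and
  \<open>y \<mapsto> (t, y)\<close>.\<close>

lemma weak_integrand_eq: "weak_integrand p v \<phi> t x = \<phi>' (t, x) (1, v t x) * p t x"
proof -
  have lin: "linear (\<phi>' (t, x))" using \<phi>' by (rule has_derivative_linear)
  have "((\<lambda>s. \<phi> (s, x)) has_derivative (\<lambda>h. \<phi>' (t, x) (h, 0))) (at t)"
    by (rule has_derivative_compose[OF _ \<phi>', of "\<lambda>s. (s, x)"]) (auto intro!: derivative_eq_intros)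
  moreover have "(\<lambda>h. \<phi>' (t, x) (h, 0)) = (*) (\<phi>' (t, x) (1, 0))"
    by (rule ext, subst \<phi>'_expand) simp
  ultimately have "((\<lambda>s. \<phi> (s, x)) has_field_derivative \<phi>' (t, x) (1, 0)) (at t)"
    by (simp only: has_field_derivative_def)
  then have d: "deriv (\<lambda>s. \<phi> (s, x)) t = \<phi>' (t, x) (1, 0)" by (rule DERIV_imp_deriv)
  have "((\<lambda>y. \<phi> (t, y)) has_derivative (\<lambda>h. \<phi>' (t, x) (0, h))) (at x)"
    by (rule has_derivative_compose[OF _ \<phi>', of "\<lambda>y. (t, y)"]) (auto intro!: derivative_eq_intros)
  then have f: "frechet_derivative (\<lambda>y. \<phi> (t, y)) (at x) = (\<lambda>h. \<phi>' (t, x) (0, h))"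
    by (rule frechet_derivative_at[symmetric])
  have "\<phi>' (t, x) (1, 0) + \<phi>' (t, x) (0, v t x) = \<phi>' (t, x) (1, v t x)"
    by (simp add: linear_add[OF lin, symmetric])
  then show ?thesis unfolding weak_integrand_def d f by simp
qed

text \<open>By the chain rule, for times in the open interval, this is the time derivative of
  \<open>\<phi> (t, X t \<omega>)\<close> along the path of \<omega>.\<close>

definition rate where "rate t \<omega> = \<phi>' (t, X t \<omega>) (1, R t \<omega>)"

lemma rate_expand:
  "rate t \<omega> = \<phi>' (t, X t \<omega>) (1, 0) + (\<Sum>i\<in>Basis. \<phi>' (t, X t \<omega>) (0, i) * (R t \<omega> \<bullet> i))"
  unfolding rate_def by (subst \<phi>'_expand) simp

text \<open>Each term on the right, apart from the constant, is a function of time times a function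
  of \<omega>, so the same bound serves for integration along a path and for expectations.\<close>

lemma rate_bound:
  "\<bar>rate t \<omega>\<bar> \<le> C (1, 0) +
    (\<Sum>i\<in>Basis. C (0, i) * (\<bar>time_deriv a t\<bar> * \<bar>Z \<omega> \<bullet> i\<bar> + \<bar>time_deriv b t\<bar> * \<bar>X1 \<omega> \<bullet> i\<bar>))"
proof -
  have "\<bar>\<phi>' (t, X t \<omega>) (0, i) * (R t \<omega> \<bullet> i)\<bar> \<le>
      C (0, i) * (\<bar>time_deriv a t\<bar> * \<bar>Z \<omega> \<bullet> i\<bar> + \<bar>time_deriv b t\<bar> * \<bar>X1 \<omega> \<bullet> i\<bar>)" for i
  proof -
    have "\<bar>R t \<omega> \<bullet> i\<bar> \<le> \<bar>time_deriv a t\<bar> * \<bar>Z \<omega> \<bullet> i\<bar> + \<bar>time_deriv b t\<bar> * \<bar>X1 \<omega> \<bullet> i\<bar>"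
      unfolding R_eq inner_add_left inner_scaleR_left abs_mult[symmetric] by (rule abs_triangle_ineq)
    then show ?thesis unfolding abs_mult by (rule mult_mono[OF C]) (simp_all add: C_nonneg)
  qed
  then have "(\<Sum>i\<in>Basis. \<bar>\<phi>' (t, X t \<omega>) (0, i) * (R t \<omega> \<bullet> i)\<bar>) \<le>
      (\<Sum>i\<in>Basis. C (0, i) * (\<bar>time_deriv a t\<bar> * \<bar>Z \<omega> \<bullet> i\<bar> + \<bar>time_deriv b t\<bar> * \<bar>X1 \<omega> \<bullet> i\<bar>))"
    by (rule sum_mono)
  then have "\<bar>\<Sum>i\<in>Basis. \<phi>' (t, X t \<omega>) (0, i) * (R t \<omega> \<bullet> i)\<bar> \<le>
      (\<Sum>i\<in>Basis. C (0, i) * (\<bar>time_deriv a t\<bar> * \<bar>Z \<omega> \<bullet> i\<bar> + \<bar>time_deriv b t\<bar> * \<bar>X1 \<omega> \<bullet> i\<bar>))"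
    by (rule order_trans[OF sum_abs])
  then show ?thesis
    unfolding rate_expand using C[of "(t, X t \<omega>)" "(1, 0)"] by linarith
qed

lemma continuous_on_rate: "continuous_on {0<..<1} (\<lambda>t. rate t \<omega>)"
proof -
  have sub: "{0<..<1} \<subseteq> {0..<1::real}" "{0<..<1} \<subseteq> {0..1::real}" by auto
  note [continuous_intros] = continuous_on_time_deriv[THEN continuous_on_subset[OF _ sub(1)]]
    continuous_on_schedule[THEN continuous_on_subset[OF _ sub(2)]]
  show ?thesis
    unfolding rate_expand X_eq R_eq
    by (intro continuous_intros continuous_on_compose2[OF cont_\<phi>']) auto
qed

text \<open>The shape of the bound on \<open>rate\<close>, with free coefficients: \<open>u\<close>
  and \<open>w\<close> are first the absolute coordinates of a single path and later their
  expectations.\<close>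

lemma set_integrable_affine_rates:
  "set_integrable lborel {0<..<1} (\<lambda>t. c + (\<Sum>i\<in>(Basis :: 'a set).
    k i * (\<bar>time_deriv a t\<bar> * u i + \<bar>time_deriv b t\<bar> * w i)))"
proof -
  have "set_integrable lborel {0<..<1} (\<lambda>t::real. c)"
    unfolding set_integrable_def
    by (intro integrable_scaleR_left integrable_real_indicator) auto
  then have "set_integrable lborel {0<..<1} (\<lambda>t. c + (\<bar>time_deriv a t\<bar> * (\<Sum>i\<in>(Basis :: 'a set). k i * u i) +
      \<bar>time_deriv b t\<bar> * (\<Sum>i\<in>(Basis :: 'a set). k i * w i)))"
    by (intro set_integral_add(1) set_integrable_mult_left set_integrable_abs set_integrable_time_deriv)
  also have "(\<lambda>t. c + (\<bar>time_deriv a t\<bar> * (\<Sum>i\<in>(Basis :: 'a set). k i * u i) +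
      \<bar>time_deriv b t\<bar> * (\<Sum>i\<in>(Basis :: 'a set). k i * w i))) =
    (\<lambda>t. c + (\<Sum>i\<in>(Basis :: 'a set). k i * (\<bar>time_deriv a t\<bar> * u i + \<bar>time_deriv b t\<bar> * w i)))"
    by (simp add: sum_distrib_left distrib_left sum.distrib mult_ac)
  finally show ?thesis .
qed

lemma set_integrable_rate: "set_integrable lborel {0<..<1} (\<lambda>t. rate t \<omega>)"
proof (rule set_integrable_bound)
  show "set_integrable lborel {0<..<1} (\<lambda>t. C (1, 0) +
      (\<Sum>i\<in>Basis. C (0, i) * (\<bar>time_deriv a t\<bar> * \<bar>Z \<omega> \<bullet> i\<bar> + \<bar>time_deriv b t\<bar> * \<bar>X1 \<omega> \<bullet> i\<bar>)))"
    by (rule set_integrable_affine_rates)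
  show "set_borel_measurable lborel {0<..<1} (\<lambda>t. rate t \<omega>)"
    using borel_measurable_continuous_on_indicator[OF _ continuous_on_rate] by (simp add: set_borel_measurable_def)
  show "AE t in lborel. t \<in> {0<..<1} \<longrightarrow> norm (rate t \<omega>) \<le> norm (C (1, 0) +
      (\<Sum>i\<in>Basis. C (0, i) * (\<bar>time_deriv a t\<bar> * \<bar>Z \<omega> \<bullet> i\<bar> + \<bar>time_deriv b t\<bar> * \<bar>X1 \<omega> \<bullet> i\<bar>)))"
    using rate_bound by (intro AE_I2 impI) (auto intro: order_trans[OF rate_bound abs_ge_self])
qed

text \<open>The fundamental theorem of calculus in its improper form: the path is continuous on the
  closed interval and its derivative is integrable on the open one. This allows schedules whose
  \<open>a\<close> has no derivative at time 1.\<close>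

lemma integral_rate_path: "(LINT t:{0<..<1}|lborel. rate t \<omega>) = \<phi> (1, X1 \<omega>) - \<phi> (0, X 0 \<omega>)"
proof -
  let ?F = "\<lambda>t. \<phi> (t, X t \<omega>)"
  have cont: "continuous_on {0..1} ?F"
    unfolding X_eq
    by (intro continuous_on_compose2[OF continuous_on_\<phi>] continuous_intros continuous_on_schedule) auto
  have "(LBINT t=ereal 0..ereal 1. rate t \<omega>) = ?F 1 - ?F 0"
  proof (rule interval_integral_FTC_integrable)
    show "(?F has_vector_derivative rate t \<omega>) (at t)" if "ereal 0 < ereal t" "ereal t < ereal 1" for t
    proof -
      have "((\<lambda>t. (t, X t \<omega>)) has_vector_derivative (1, R t \<omega>)) (at t)"
        unfolding X_eq R_eq using that has_time_deriv[of t]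
        by (auto simp: has_real_derivative_iff_has_vector_derivative intro!: derivative_eq_intros has_vector_derivative_Pair)
      from vector_derivative_diff_chain_within[OF this, of \<phi> "\<phi>' (t, X t \<omega>)"]
      show ?thesis using \<phi>' by (simp add: rate_def comp_def has_derivative_at_withinI)
    qed
    show "isCont (\<lambda>t. rate t \<omega>) t" if "ereal 0 < ereal t" "ereal t < ereal 1" for t
      using continuous_on_rate that by (simp add: continuous_on_eq_continuous_at)
    show "set_integrable lborel (einterval (ereal 0) (ereal 1)) (\<lambda>t. rate t \<omega>)"
      using set_integrable_rate by simp
    show "((?F \<circ> real_of_ereal) \<longlongrightarrow> ?F 0) (at_right (ereal 0))"
      "((?F \<circ> real_of_ereal) \<longlongrightarrow> ?F 1) (at_left (ereal 1))"
      using cont unfolding ereal_tendsto_simps1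
      by (auto dest: continuous_on_Icc_at_rightD continuous_on_Icc_at_leftD)
  qed simp
  then show ?thesis by (simp add: interval_integral_Ioo)
qed

lemma borel_measurable_rate [measurable]:
  "(\<lambda>(t, \<omega>). indicator {0<..<1} t * rate t \<omega>) \<in> borel_measurable (lborel \<Otimes>\<^sub>M M)"
proof -
  \<comment> \<open>The schedule and its derivatives are controlled on the open interval only.
    Extended by zero they are Borel on the whole line, and the indicator in front of
    \<open>rate\<close> makes the change invisible.\<close>
  define cut where "cut f t = indicator {0<..<1} t *\<^sub>R f t" for f :: "real \<Rightarrow> real" and t
  have sub: "{0<..<1} \<subseteq> {0..<1::real}" "{0<..<1} \<subseteq> {0..1::real}" by auto
  have [measurable]: "cut a \<in> borel_measurable borel" "cut b \<in> borel_measurable borel"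
    "cut (time_deriv a) \<in> borel_measurable borel" "cut (time_deriv b) \<in> borel_measurable borel"
    unfolding cut_def
    by (intro borel_measurable_continuous_on_indicator continuous_on_time_deriv[THEN continuous_on_subset[OF _ sub(1)]]
      continuous_on_schedule[THEN continuous_on_subset[OF _ sub(2)]]; simp)+
  define x where "x t \<omega> = cut a t *\<^sub>R Z \<omega> + cut b t *\<^sub>R X1 \<omega>" for t \<omega>
  define r where "r t \<omega> = cut (time_deriv a) t *\<^sub>R Z \<omega> + cut (time_deriv b) t *\<^sub>R X1 \<omega>" for t \<omega>
  have eq: "(\<lambda>(t, \<omega>). indicator {0<..<1} t * rate t \<omega>) = (\<lambda>(t, \<omega>). indicator {0<..<1} t *
      (\<phi>' (t, x t \<omega>) (1, 0) + (\<Sum>i\<in>Basis. \<phi>' (t, x t \<omega>) (0, i) * (r t \<omega> \<bullet> i))))"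
    by (auto simp: fun_eq_iff rate_expand X_eq R_eq x_def r_def cut_def split: split_indicator)
  have [measurable]: "(\<lambda>w. (fst w, x (fst w) (snd w))) \<in> lborel \<Otimes>\<^sub>M M \<rightarrow>\<^sub>M borel"
    "(\<lambda>w. r (fst w) (snd w)) \<in> lborel \<Otimes>\<^sub>M M \<rightarrow>\<^sub>M borel"
    unfolding x_def r_def by measurable
  have [measurable]: "(\<lambda>w. \<phi>' (fst w, x (fst w) (snd w)) h) \<in> borel_measurable (lborel \<Otimes>\<^sub>M M)" for h
    by (rule measurable_compose[OF _ borel_measurable_\<phi>(2)]) measurable
  show ?thesis unfolding eq case_prod_beta' by measurable
qed

sublocale T: pair_sigma_finite "lborel :: real measure" M ..

text \<open>Absolute integrability on the product space, which justifies exchanging the time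
  integral with the expectation.\<close>

lemma integrable_rate: "integrable (lborel \<Otimes>\<^sub>M M) (\<lambda>(t, \<omega>). indicator {0<..<1} t * rate t \<omega>)"
proof (rule T.Fubini_integrable)
  \<comment> \<open>\<open>B\<close> dominates \<open>rate\<close>. Its expectation has the same
    shape with first absolute moments as coefficients, hence is integrable in time for the same
    reason as along one path.\<close>
  define B where "B t \<omega> = C (1, 0) +
    (\<Sum>i\<in>Basis. C (0, i) * (\<bar>time_deriv a t\<bar> * \<bar>Z \<omega> \<bullet> i\<bar> + \<bar>time_deriv b t\<bar> * \<bar>X1 \<omega> \<bullet> i\<bar>))" for t \<omega>
  have intB: "integrable M (B t)" for t
    unfolding B_def using integrable_inner_Z integrable_X1
    by (auto intro!: Bochner_Integration.integrable_add Bochner_Integration.integrable_sum)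
  have EB: "(LINT \<omega>|M. B t \<omega>) = C (1, 0) + (\<Sum>i\<in>Basis. C (0, i) *
      (\<bar>time_deriv a t\<bar> * (LINT \<omega>|M. \<bar>Z \<omega> \<bullet> i\<bar>) + \<bar>time_deriv b t\<bar> * (LINT \<omega>|M. \<bar>X1 \<omega> \<bullet> i\<bar>)))" for t
    unfolding B_def using integrable_inner_Z integrable_X1 by (simp add: prob_space)
  have bound: "\<bar>rate t \<omega>\<bar> \<le> B t \<omega>" for t \<omega> unfolding B_def by (rule rate_bound)
  have int_t: "integrable M (\<lambda>\<omega>. indicator {0<..<1} t * rate t \<omega>)" for t
  proof (rule Bochner_Integration.integrable_bound[OF intB])
    show "(\<lambda>\<omega>. indicator {0<..<1} t * rate t \<omega>) \<in> borel_measurable M"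
      using measurable_compose[OF measurable_Pair1' borel_measurable_rate, of t] by simp
    show "AE \<omega> in M. norm (indicator {0<..<1} t * rate t \<omega>) \<le> norm (B t \<omega>)"
      using bound[of t] by (intro AE_I2) (auto split: split_indicator intro: order_trans[OF bound abs_ge_self])
  qed
  then show "AE t in lborel. integrable M (\<lambda>\<omega>. case (t, \<omega>) of (t, \<omega>) \<Rightarrow> indicator {0<..<1} t * rate t \<omega>)"
    by simp
  have EB_int: "set_integrable lborel {0<..<1} (\<lambda>t. LINT \<omega>|M. B t \<omega>)"
    unfolding EB by (rule set_integrable_affine_rates)
  show "integrable lborel (\<lambda>t. LINT \<omega>|M. norm (case (t, \<omega>) of (t, \<omega>) \<Rightarrow> indicator {0<..<1} t * rate t \<omega>))"
  proof (rule Bochner_Integration.integrable_bound[OF EB_int[unfolded set_integrable_def]])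
    show "AE t in lborel. norm (LINT \<omega>|M. norm (case (t, \<omega>) of (t, \<omega>) \<Rightarrow> indicator {0<..<1} t * rate t \<omega>))
      \<le> norm (indicator {0<..<1} t *\<^sub>R (LINT \<omega>|M. B t \<omega>))"
    proof (rule AE_I2)
      fix t :: real
      have "(LINT \<omega>|M. \<bar>indicator {0<..<1} t * rate t \<omega>\<bar>) \<le> (LINT \<omega>|M. indicator {0<..<1} t * B t \<omega>)"
        using intB[of t] integrable_abs[OF int_t[of t]] bound
        by (intro integral_mono) (auto split: split_indicator)
      then show "norm (LINT \<omega>|M. norm (case (t, \<omega>) of (t, \<omega>) \<Rightarrow> indicator {0<..<1} t * rate t \<omega>))
        \<le> norm (indicator {0<..<1} t *\<^sub>R (LINT \<omega>|M. B t \<omega>))"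
        by (simp add: abs_of_nonneg)
    qed
  qed measurable
qed measurable

text \<open>This is where the rate gives way to the velocity. The spatial integral is the
  expectation of a function of \<open>X t\<close> with velocity coordinates, each multiplied by a
  bounded function of \<open>X t\<close>, so conditioning restores the rate.\<close>

lemma
  assumes t: "t \<in> {0<..<1}"
  shows integrable_weak_integrand: "integrable lborel (weak_integrand p v \<phi> t)"
    and integral_weak_integrand: "(LINT x|lborel. weak_integrand p v \<phi> t x) = (LINT \<omega>|M. rate t \<omega>)"
proof -
  note [measurable] = borel_measurable_velocity_at[OF t]
  have at: "a t > 0" using t by (intro a_pos) auto
  have D: "distributed M lborel (X t) (\<lambda>x. ennreal (p t x))" using t by (intro distributed_marginal) auto
  have [measurable]: "(\<lambda>x. \<phi>' (t, x) h) \<in> borel_measurable borel" for h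
    by (rule measurable_compose[OF _ borel_measurable_\<phi>(2)]) measurable
  define g where "g x = \<phi>' (t, x) (1, 0) + (\<Sum>i\<in>Basis. \<phi>' (t, x) (0, i) * (v t x \<bullet> i))" for x
  have [measurable]: "g \<in> borel_measurable borel" unfolding g_def by measurable
  have w: "weak_integrand p v \<phi> t = (\<lambda>x. p t x * g x)"
    unfolding weak_integrand_eq g_def by (subst \<phi>'_expand) (simp add: mult.commute)
  have int0: "integrable M (\<lambda>\<omega>. \<phi>' (t, X t \<omega>) (1, 0))"
    by (rule integrable_const_bound[where B = "C (1, 0)"]) (auto simp: C)
  have E: "integrable M (\<lambda>\<omega>. \<phi>' (t, X t \<omega>) (0, i) * (R t \<omega> \<bullet> i))"
    "integrable M (\<lambda>\<omega>. \<phi>' (t, X t \<omega>) (0, i) * (v t (X t \<omega>) \<bullet> i))"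
    "(LINT \<omega>|M. \<phi>' (t, X t \<omega>) (0, i) * (R t \<omega> \<bullet> i)) = (LINT \<omega>|M. \<phi>' (t, X t \<omega>) (0, i) * (v t (X t \<omega>) \<bullet> i))"
    if "i \<in> Basis" for i
    using expectation_mult_cond_mean[OF at that, where f = "\<lambda>x. \<phi>' (t, x) (0, i)" and C = "C (0, i)"
        and \<beta> = "b t" and \<alpha>' = "time_deriv a t" and \<beta>' = "time_deriv b t"]
    by (simp_all add: C velocity_eq[OF t] X_eq R_eq)
  have "integrable M (\<lambda>\<omega>. g (X t \<omega>))"
    unfolding g_def using int0 E(2) by simp
  then show "integrable lborel (weak_integrand p v \<phi> t)"
    unfolding w using distributed_integrable[OF D, of g] by (simp add: marginal_density_nonneg)
  have "(LINT x|lborel. weak_integrand p v \<phi> t x) = (LINT \<omega>|M. g (X t \<omega>))"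
    unfolding w using distributed_integral[OF D, of g] by (simp add: marginal_density_nonneg)
  also have "\<dots> = (LINT \<omega>|M. rate t \<omega>)"
    unfolding g_def rate_expand using int0 E by simp
  finally show "(LINT x|lborel. weak_integrand p v \<phi> t x) = (LINT \<omega>|M. rate t \<omega>)" .
qed

text \<open>Fubini brings the time integral inside the expectation, where it telescopes along each
  path to the difference of end point values.\<close>

lemma
  shows set_integrable_weak_integrand:
      "set_integrable lborel {0<..<1} (\<lambda>t. LINT x|lborel. weak_integrand p v \<phi> t x)"
    and integral_weak_integrand_eq:
      "(LINT t:{0<..<1}|lborel. LINT x|lborel. weak_integrand p v \<phi> t x) =
        (LINT \<omega>|M. \<phi> (1, X1 \<omega>) - \<phi> (0, X 0 \<omega>))"
proof -
  have eq: "indicator {0<..<1} t *\<^sub>R (LINT x|lborel. weak_integrand p v \<phi> t x) =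
      (LINT \<omega>|M. indicator {0<..<1} t * rate t \<omega>)" for t
    by (auto simp: integral_weak_integrand split: split_indicator)
  show "set_integrable lborel {0<..<1} (\<lambda>t. LINT x|lborel. weak_integrand p v \<phi> t x)"
    using T.integrable_fst'[OF integrable_rate] unfolding set_integrable_def eq by simp
  have "(LINT t:{0<..<1}|lborel. LINT x|lborel. weak_integrand p v \<phi> t x) =
      (LINT t|lborel. LINT \<omega>|M. indicator {0<..<1} t * rate t \<omega>)"
    unfolding set_lebesgue_integral_def eq ..
  also have "\<dots> = (LINT \<omega>|M. LINT t|lborel. indicator {0<..<1} t * rate t \<omega>)"
    by (rule T.Fubini_integral[OF integrable_rate, symmetric])
  also have "\<dots> = (LINT \<omega>|M. \<phi> (1, X1 \<omega>) - \<phi> (0, X 0 \<omega>))"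
    using integral_rate_path by (simp add: set_lebesgue_integral_def)
  finally show "(LINT t:{0<..<1}|lborel. LINT x|lborel. weak_integrand p v \<phi> t x) =
      (LINT \<omega>|M. \<phi> (1, X1 \<omega>) - \<phi> (0, X 0 \<omega>))" .
qed

text \<open>At times 0 and 1 this converts the expectations of end point values into the boundary
  terms of the weak formulation.\<close>

lemma
  assumes t: "t \<in> {0..1}"
  shows integrable_test_marginal: "integrable lborel (\<lambda>x. \<phi> (t, x) * p t x)"
    and integrable_test_X: "integrable M (\<lambda>\<omega>. \<phi> (t, X t \<omega>))"
    and integral_test_marginal: "(LINT x|lborel. \<phi> (t, x) * p t x) = (LINT \<omega>|M. \<phi> (t, X t \<omega>))"
proof -
  note D = distributed_marginal[OF t]
  have [measurable]: "(\<lambda>x. \<phi> (t, x)) \<in> borel_measurable borel"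
    by (rule measurable_compose[OF _ borel_measurable_\<phi>(1)]) measurable
  obtain C0 where "\<bar>\<phi> z\<bar> \<le> C0" for z using bounded by blast
  then show int: "integrable M (\<lambda>\<omega>. \<phi> (t, X t \<omega>))"
    by (intro integrable_const_bound[where B = C0]) auto
  then show "integrable lborel (\<lambda>x. \<phi> (t, x) * p t x)"
    using distributed_integrable[OF D, of "\<lambda>x. \<phi> (t, x)"] by (simp add: marginal_density_nonneg mult.commute)
  show "(LINT x|lborel. \<phi> (t, x) * p t x) = (LINT \<omega>|M. \<phi> (t, X t \<omega>))"
    using distributed_integral[OF D, of "\<lambda>x. \<phi> (t, x)"] by (simp add: marginal_density_nonneg mult.commute)
qed

lemma weak_equation:
  "(LINT t:{0<..<1}|lborel. LINT x|lborel. weak_integrand p v \<phi> t x) =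
    (LINT x|lborel. \<phi> (1, x) * p 1 x) - (LINT x|lborel. \<phi> (0, x) * p 0 x)"
  using integral_weak_integrand_eq integrable_test_X[of 1] integrable_test_X[of 0]
  by (simp add: integral_test_marginal)

end

section \<open>Assembling the weak equation over all test functions\<close>

lemma (in scheduled_interpolation) weak_continuity_equation_marginal: "weak_continuity_equation p v"
  unfolding weak_continuity_equation_def
proof (intro conjI allI impI)
  fix \<phi> :: "real \<times> 'a \<Rightarrow> real" assume "test_function \<phi>"
  from test_function_derivative[OF this] obtain \<phi>' C where
    *: "\<forall>z. (\<phi> has_derivative \<phi>' z) (at z)" "\<forall>h. continuous_on UNIV (\<lambda>z. \<phi>' z h)"
      "\<forall>z h. \<bar>\<phi>' z h\<bar> \<le> C h" "\<exists>C0. \<forall>z. \<bar>\<phi> z\<bar> \<le> C0"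
    by blast
  interpret tested_interpolation M Z X1 \<nu> a b \<phi> \<phi>' C by unfold_locales (use * in blast)+
  show "\<forall>t\<in>{0<..<1}. integrable lborel (weak_integrand p v \<phi> t)"
    by (intro ballI integrable_weak_integrand)
  show "integrable lborel (\<lambda>x. \<phi> (0, x) * p 0 x)" "integrable lborel (\<lambda>x. \<phi> (1, x) * p 1 x)"
    by (rule integrable_test_marginal; simp)+
  show "set_integrable lborel {0<..<1} (\<lambda>t. LINT x|lborel. weak_integrand p v \<phi> t x)"
    by (rule set_integrable_weak_integrand)
  show "(LINT t:{0<..<1}|lborel. LINT x|lborel. weak_integrand p v \<phi> t x) =
      (LINT x|lborel. \<phi> (1, x) * p 1 x) - (LINT x|lborel. \<phi> (0, x) * p 0 x)"
    by (rule weak_equation)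
qed (rule borel_measurable_velocity velocity_locally_integrable)+

text \<open>The conjuncts around the weak equation certify that the definitions take their intended
  values: the densities represent the laws, \<open>THE\<close> in \<open>cond_mean\<close> selects a
  genuine continuous version, and \<open>Lim\<close> at time 0 is an actual limit.\<close>

theorem theorem12:
  fixes M :: "'w measure" and Z X1 :: "'w \<Rightarrow> 'a::euclidean_space"
    and \<nu> \<mu> :: "'a measure" and a b :: "real \<Rightarrow> real"
    and X :: "real \<Rightarrow> 'w \<Rightarrow> 'a" and p :: "real \<Rightarrow> 'a \<Rightarrow> real" and v :: "real \<Rightarrow> 'a \<Rightarrow> 'a"
  assumes "interpolation_schedule a b"
    and "prob_space \<nu>" and "sets \<nu> = sets borel"
    and "absolutely_continuous lborel \<nu>"
    and "integrable \<nu> (\<lambda>x. (norm x)\<^sup>2)"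
    and "prob_space M"
    and "Z \<in> borel_measurable M" and "X1 \<in> borel_measurable M"
    and "distr M borel Z = std_gaussian" and "distr M borel X1 = \<nu>"
    and "prob_space.indep_var M borel Z borel X1"
  defines "X \<equiv> interpolant a b Z X1"
    and "\<mu> \<equiv> distr M borel (interpolant a b Z X1 0)"
    and "p \<equiv> marginal_density M a b Z X1"
    and "v \<equiv> velocity M a b Z X1"
  shows "(\<forall>t\<in>{0..1}. distributed M lborel (X t) (\<lambda>x. ennreal (p t x))) \<and>
         (\<forall>t\<in>{0<..<1}. continuous_on UNIV (v t) \<and>
            is_cond_mean M (X t) (\<lambda>\<omega>. time_deriv a t *\<^sub>R Z \<omega> + time_deriv b t *\<^sub>R X1 \<omega>) (v t)) \<and>
         (\<forall>x. ((\<lambda>t. v t x) \<longlongrightarrow> v 0 x) (at_right 0)) \<and>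
         weak_continuity_equation p v \<and>
         (AE x in lborel. ennreal (p 0 x) = RN_deriv lborel \<mu> x) \<and>
         (AE x in lborel. ennreal (p 1 x) = RN_deriv lborel \<nu> x)"
proof -
  interpret prob_space M by fact
  note [measurable] = \<open>X1 \<in> borel_measurable M\<close>
  have "integrable (distr M borel X1) (\<lambda>x. (norm x)\<^sup>2)"
    using \<open>integrable \<nu> (\<lambda>x. (norm x)\<^sup>2)\<close> \<open>distr M borel X1 = \<nu>\<close> by simp
  then have "integrable M (\<lambda>\<omega>. (norm (X1 \<omega>))\<^sup>2)"
    by (rule integrable_distr[OF \<open>X1 \<in> borel_measurable M\<close>])
  \<comment> \<open>On a probability space a finite second moment yields a finite first moment, the
    form in which the locale asks for integrability.\<close>
  then have "integrable M (\<lambda>\<omega>. norm (X1 \<omega>))"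
    by (rule square_integrable_imp_integrable[rotated]) measurable
  then have "integrable M X1"
    using \<open>X1 \<in> borel_measurable M\<close> by (simp only: integrable_norm_iff)
  interpret scheduled_interpolation M Z X1 \<nu> a b
    by unfold_locales fact+
  show ?thesis
    unfolding X_def \<mu>_def p_def v_def
  proof (intro conjI ballI allI)
    show "AE x in lborel. ennreal (marginal_density M a b Z X1 0 x) =
        RN_deriv lborel (distr M borel (interpolant a b Z X1 0)) x"
      by (rule marginal_density_eq) simp
    show "AE x in lborel. ennreal (marginal_density M a b Z X1 1 x) = RN_deriv lborel \<nu> x"
      using marginal_density_eq[of 1] by (simp add: distr_X1)
  qed (rule distributed_marginal continuous_on_velocity is_cond_mean_velocity[unfolded R_eq]
      velocity_tendsto_0 weak_continuity_equation_marginal; assumption)+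
qed

end
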